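(* Let $H$ be a complex Hilbert space and let $\mathscr{A}$ be a factor on $H$. Let $\mathscr{E}(\mathscr{A})=[0,I]\cap\mathscr{A}$ be the set of all effects in $\mathscr{A}$. If $\phi:\mathscr{E}(\mathscr{A})\to\mathscr{E}(\mathscr{A})$ is a bijective affine function, then there is a map $\Phi:\mathscr{A}\to\mathscr{A}$ which is either a *-automorphism or a *-antiautomorphism of $\mathscr{A}$ such that either \[ \phi(A)=\Phi(A)\qquad\text{for all } A\in\mathscr{E}(\mathscr{A}), \] or \[ \phi(A)=\Phi(I-A)\qquad\text{for all } A\in\mathscr{E}(\mathscr{A}). \]
   Context: $B(H)$ denotes the $C^*$-algebra of all bounded linear operators on $H$, and $I$ is the identity operator on $H$. The operator interval $[0,I]$ is the set of all positive operators $A\in B(H)$ with $A\le I$, where $\le$ is the usual order on self-adjoint operators. A von Neumann algebra $\mathscr{A}$ on $H$ is a factor if its center equals $\mathbb{C}I$. If $X,Y$ are complex linear spaces and $C\subset X$ is convex, a function $\psi:C\to Y$ is affine if $\psi(\lambda x+(1-\lambda)y)=\lambda\psi(x)+(1-\lambda)\psi(y)$ for all $x,y\in C$ and $\lambda\in[0,1]$. A *-automorphism of $\mathscr{A}$ is a bijective (complex-)linear map $\Phi:\mathscr{A}\to\mathscr{A}$ with $\Phi(A^* )=\Phi(A)^*$ and $\Phi(AB)=\Phi(A)\Phi(B)$ for all $A,B\in\mathscr{A}$. A *-antiautomorphism of $\mathscr{A}$ is a bijective (complex-)linear map $\Phi:\mathscr{A}\to\mathscr{A}$ with $\Phi(A^*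 )=\Phi(A)^*$ and $\Phi(BA)=\Phi(A)\Phi(B)$ for all $A,B\in\mathscr{A}$. *)

theory Defs
  imports "HOL-Analysis.Analysis"
begin

text \<open>
  A complex Hilbert space carries its underlying real Hilbert space structure, with
  real inner product the real part of the complex one; the library norm is therefore
  \<open>sqrt (Re (cinner x x))\<close>.  The form \<open>cinner\<close> is linear in the first argument.
  The zero space is not excluded.
\<close>

class chilbert_space = real_inner + complete_space +
  fixes scaleC :: "complex \<Rightarrow> 'a \<Rightarrow> 'a"  (infixr \<open>*\<^sub>C\<close> 75)
    and cinner :: "'a \<Rightarrow> 'a \<Rightarrow> complex"
  assumes scaleC_add_right: "c *\<^sub>C (x + y) = c *\<^sub>C x + c *\<^sub>C y"
    and scaleC_add_left: "(c + d) *\<^sub>C x = c *\<^sub>C x + d *\<^sub>C x"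
    and scaleC_scaleC: "c *\<^sub>C (d *\<^sub>C x) = (c * d) *\<^sub>C x"
    and scaleC_of_real: "complex_of_real r *\<^sub>C x = r *\<^sub>R x"
    and cinner_commute: "cinner x y = cnj (cinner y x)"
    and cinner_add_left: "cinner (x + y) z = cinner x z + cinner y z"
    and cinner_scaleC_left: "cinner (c *\<^sub>C x) y = c * cinner x y"
    and Re_cinner: "Re (cinner x y) = inner x y"

instantiation complex :: chilbert_space
begin

definition scaleC_complex :: "complex \<Rightarrow> complex \<Rightarrow> complex"
  where "scaleC_complex c x = c * x"

definition cinner_complex :: "complex \<Rightarrow> complex \<Rightarrow> complex"
  where "cinner_complex x y = x * cnj y"

instance
  by standard
    (simp_all add: scaleC_complex_def cinner_complex_def inner_complex_def algebra_simps
      scaleR_conv_of_real)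

end

lemma Im_cinner: "Im (cinner x y) = - inner (\<i> *\<^sub>C x) y"
  using Re_cinner[of "\<i> *\<^sub>C x" y] by (simp add: cinner_scaleC_left)

lemma norm_scaleC: "norm (c *\<^sub>C x) = cmod c * norm x"
proof -
  have "cinner (c *\<^sub>C x) (c *\<^sub>C x) = c * (cnj c * cinner x x)"
    by (metis cinner_scaleC_left cinner_commute complex_cnj_mult)
  also have "\<dots> = complex_of_real ((cmod c)\<^sup>2) * cinner x x"
    by (simp only: complex_norm_square mult.assoc)
  finally have "inner (c *\<^sub>C x) (c *\<^sub>C x) = (cmod c)\<^sup>2 * inner x x"
    by (simp add: Re_cinner[symmetric])
  then show ?thesis
    by (simp add: norm_eq_sqrt_inner real_sqrt_mult)
qed

text \<open>
  Library bounded linear maps are real-linear; \<open>bounded_ops\<close> singles out the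
  complex-linear ones, i.e. $B(H)$.
\<close>

definition bounded_ops :: "('h::chilbert_space \<Rightarrow>\<^sub>L 'h) set"
  where "bounded_ops = {T :: 'h \<Rightarrow>\<^sub>L 'h. \<forall>c x. T (c *\<^sub>C x) = c *\<^sub>C T x}"

lift_definition scaleC_op :: "complex \<Rightarrow> ('h::chilbert_space \<Rightarrow>\<^sub>L 'h) \<Rightarrow> ('h \<Rightarrow>\<^sub>L 'h)"
  is "\<lambda>c T x. c *\<^sub>C T x"
proof -
  fix c :: complex and T :: "'h \<Rightarrow> 'h"
  assume "bounded_linear T"
  moreover have "bounded_linear (\<lambda>x::'h. c *\<^sub>C x)"
  proof (rule bounded_linear_intro[where K = "cmod c"])
    fix r :: real and x y :: 'h
    show "c *\<^sub>C (x + y) = c *\<^sub>C x + c *\<^sub>C y" by (rule scaleC_add_right)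
    show "c *\<^sub>C (r *\<^sub>R x) = r *\<^sub>R (c *\<^sub>C x)"
      by (simp add: scaleC_of_real[symmetric] scaleC_scaleC mult.commute)
    show "norm (c *\<^sub>C x) \<le> norm x * cmod c"
      by (simp add: norm_scaleC mult.commute)
  qed
  ultimately show "bounded_linear (\<lambda>x. c *\<^sub>C T x)"
    by (rule bounded_linear_compose[rotated])
qed

definition adj :: "('h::chilbert_space \<Rightarrow>\<^sub>L 'h) \<Rightarrow> ('h \<Rightarrow>\<^sub>L 'h)"
  where "adj T = (THE S :: 'h \<Rightarrow>\<^sub>L 'h. \<forall>x y. cinner (T x) y = cinner x (S y))"

text \<open>The adjoint is well defined, by the Riesz representation theorem.\<close>

lemma riesz_real:
  fixes f :: "'a::{real_inner, complete_space} \<Rightarrow> real"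
  assumes "bounded_linear f"
  obtains z where "\<And>x. f x = inner z x"
proof -
  interpret f: bounded_linear f by fact
  define J where "J x = inner x x / 2 - f x" for x
  obtain K where K: "\<And>x. norm (f x) \<le> norm x * K" using f.bounded by blast
  have lower: "- (K\<^sup>2 / 2) \<le> J x" for x
  proof -
    have "f x \<le> norm x * K" using K[of x] by simp
    moreover have "0 \<le> (norm x - K)\<^sup>2" by simp
    ultimately show ?thesis
      by (simp add: J_def dot_square_norm power2_diff)
  qed
  define m where "m = Inf (range J)"
  have bdd: "bdd_below (range J)" using lower by (rule bdd_belowI2)
  have m_le: "m \<le> J x" for x unfolding m_def by (rule cInf_lower[OF _ bdd]) simp
  have "\<exists>x. J x < m + 1 / Suc n" for n
    using cInf_lessD[of "range J" "m + 1 / Suc n"] by (auto simp: m_def)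
  then obtain X where X: "\<And>n. J (X n) < m + 1 / Suc n" by metis
  have para: "(norm (x - y))\<^sup>2 \<le> 4 * ((J x - m) + (J y - m))" for x y
  proof -
    have "J ((1/2) *\<^sub>R (x + y)) = J x / 2 + J y / 2 - (norm (x - y))\<^sup>2 / 8"
      by (simp add: J_def f.add f.scaleR dot_square_norm[symmetric] inner_simps inner_commute field_simps)
    with m_le[of "(1/2) *\<^sub>R (x + y)"] show ?thesis by (simp add: algebra_simps)
  qed
  have "Cauchy X"
  proof (rule metric_CauchyI)
    fix e :: real assume e: "0 < e"
    then obtain N where N: "1 / Suc N < e\<^sup>2 / 8"
      using nat_approx_posE[of "e\<^sup>2 / 8"] by auto
    have "dist (X i) (X j) < e" if "N \<le> i" "N \<le> j" for i j
    proof -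
      have lt: "J (X k) - m < e\<^sup>2 / 8" if "N \<le> k" for k
      proof -
        have "1 / real (Suc k) \<le> 1 / real (Suc N)"
          using that by (simp add: frac_le)
        also note N
        finally have "1 / real (Suc k) < e\<^sup>2 / 8" .
        with X[of k] show ?thesis by (simp only: diff_less_eq)
      qed
      have "(norm (X i - X j))\<^sup>2 < e\<^sup>2"
        using para[of "X i" "X j"] lt[OF \<open>N \<le> i\<close>] lt[OF \<open>N \<le> j\<close>] by simp
      with e show ?thesis
        by (simp add: dist_norm power2_less_imp_less)
    qed
    then show "\<exists>M. \<forall>i\<ge>M. \<forall>j\<ge>M. dist (X i) (X j) < e" by blast
  qed
  then obtain z where z: "X \<longlonglongrightarrow> z" using Cauchy_convergent_iff convergent_def by blast
  have "(\<lambda>n. J (X n)) \<longlonglongrightarrow> J z"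
    unfolding J_def by (intro tendsto_intros z f.tendsto) simp
  moreover have "(\<lambda>n. m + 1 / Suc n) \<longlonglongrightarrow> m + 0"
    by (intro tendsto_intros LIMSEQ_Suc[OF lim_1_over_n])
  ultimately have "J z \<le> m + 0"
    by (rule LIMSEQ_le) (use X less_imp_le in blast)
  then have min: "J z \<le> J y" for y using m_le[of y] by simp
  have "f h = inner z h" for h
  proof (cases "h = 0")
    case False
    define a where "a = inner z h - f h"
    define t where "t = - a / inner h h"
    have "J (z + t *\<^sub>R h) = J z + t * a + t\<^sup>2 * inner h h / 2"
      by (simp add: J_def a_def f.add f.scaleR inner_simps inner_commute power2_eq_square algebra_simps)
    also have "\<dots> = J z - a\<^sup>2 / (2 * inner h h)"
      using False by (simp add: t_def power2_eq_square field_simps)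
    finally have "a\<^sup>2 / (2 * inner h h) \<le> 0" using min[of "z + t *\<^sub>R h"] by simp
    moreover have "0 < inner h h" using False by simp
    ultimately have "a\<^sup>2 \<le> 0" by (simp add: divide_le_0_iff)
    then show ?thesis by (simp add: a_def)
  qed simp
  then show thesis by (rule that)
qed

lemma adj_unique:
  assumes "\<And>x y. cinner (T x) y = cinner x (blinfun_apply S y)"
    and "\<And>x y. cinner (T x) y = cinner x (blinfun_apply S' y)"
  shows "S = S'"
proof (rule blinfun_eqI)
  fix y
  have "inner x (S y) = inner x (S' y)" for x
    using assms by (metis Re_cinner)
  then show "S y = S' y" by (metis inner_commute vector_eq_ldot)
qed

lemma adj_exists:
  fixes T :: "'h::chilbert_space \<Rightarrow>\<^sub>L 'h"
  assumes T: "T \<in> bounded_ops"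
  obtains S :: "'h \<Rightarrow>\<^sub>L 'h" where "\<And>x y. cinner (T x) y = cinner x (S y)"
proof -
  have "\<exists>z. \<forall>x. inner (T x) y = inner z x" for y
    by (rule riesz_real[of "\<lambda>x. inner (T x) y"])
      (auto intro: bounded_linear_compose[OF bounded_linear_inner_left blinfun.bounded_linear_right])
  then obtain S where S: "\<And>x y. inner (T x) y = inner (S y) x" by metis
  have "bounded_linear S"
  proof (rule bounded_linear_intro[where K = "norm T"])
    fix x y :: 'h and r :: real
    show "S (x + y) = S x + S y"
      by (rule vector_eq_rdot[THEN iffD1]) (simp add: inner_add_left S[symmetric] inner_add_right)
    show "S (r *\<^sub>R x) = r *\<^sub>R S x"
      by (rule vector_eq_rdot[THEN iffD1]) (simp add: S[symmetric])
    have "norm (S x) * norm (S x) = inner (T (S x)) x"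
      by (simp add: S dot_square_norm power2_eq_square)
    also have "\<dots> \<le> norm (T (S x)) * norm x" by (rule norm_cauchy_schwarz)
    also have "\<dots> \<le> norm T * norm (S x) * norm x"
      by (rule mult_right_mono[OF norm_blinfun]) simp
    finally have "norm (S x) * norm (S x) \<le> norm (S x) * (norm x * norm T)"
      by (simp add: algebra_simps)
    then show "norm (S x) \<le> norm x * norm T"
      by (cases "S x = 0") auto
  qed
  then have app: "Blinfun S y = S y" for y by (simp add: bounded_linear_Blinfun_apply)
  have "cinner (T x) y = cinner x (Blinfun S y)" for x y
  proof (rule complex_eqI)
    show "Re (cinner (T x) y) = Re (cinner x (Blinfun S y))"
      by (simp add: Re_cinner S app inner_commute[of "S y"])
    have "\<i> *\<^sub>C T x = T (\<i> *\<^sub>C x)" using T by (simp add: bounded_ops_def)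
    then show "Im (cinner (T x) y) = Im (cinner x (Blinfun S y))"
      by (simp add: Im_cinner S app inner_commute[of _ "S y"])
  qed
  then show thesis by (rule that)
qed

lemma cinner_adj:
  assumes "T \<in> bounded_ops"
  shows "cinner (T x) y = cinner x (adj T y)"
proof -
  obtain S where S: "\<And>x y. cinner (T x) y = cinner x (blinfun_apply S y)"
    using adj_exists[OF assms] by blast
  have "\<forall>x y. cinner (T x) y = cinner x (adj T y)"
    unfolding adj_def by (rule theI[of _ S]) (use S adj_unique in blast)+
  then show ?thesis by blast
qed

definition selfadjoint_op :: "('h::chilbert_space \<Rightarrow>\<^sub>L 'h) \<Rightarrow> bool"
  where "selfadjoint_op T \<longleftrightarrow> T \<in> bounded_ops \<and> adj T = T"

definition positive_op :: "('h::chilbert_space \<Rightarrow>\<^sub>L 'h) \<Rightarrow> bool"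
  where "positive_op T \<longleftrightarrow> T \<in> bounded_ops \<and> (\<forall>x. cinner (T x) x \<in> \<real>\<^sub>\<ge>\<^sub>0)"

definition op_le :: "('h::chilbert_space \<Rightarrow>\<^sub>L 'h) \<Rightarrow> ('h \<Rightarrow>\<^sub>L 'h) \<Rightarrow> bool"
  where "op_le S T \<longleftrightarrow> selfadjoint_op S \<and> selfadjoint_op T \<and> positive_op (T - S)"

text \<open>
  Unital \<open>*\<close>-subalgebras of $B(H)$ closed in the strong operator topology.  That topology lives
  on all real-linear bounded maps, in which \<open>bounded_ops\<close> is itself closed, so closedness
  there is the same as closedness relative to $B(H)$.
\<close>

definition von_neumann_algebra :: "('h::chilbert_space \<Rightarrow>\<^sub>L 'h) set \<Rightarrow> bool"
  where "von_neumann_algebra \<A> \<longleftrightarrow>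
    \<A> \<subseteq> bounded_ops \<and> id_blinfun \<in> \<A> \<and>
    (\<forall>S\<in>\<A>. \<forall>T\<in>\<A>. S + T \<in> \<A>) \<and>
    (\<forall>c. \<forall>T\<in>\<A>. scaleC_op c T \<in> \<A>) \<and>
    (\<forall>S\<in>\<A>. \<forall>T\<in>\<A>. S o\<^sub>L T \<in> \<A>) \<and>
    (\<forall>T\<in>\<A>. adj T \<in> \<A>) \<and>
    closedin strong_operator_topology \<A>"

definition op_center :: "('h::chilbert_space \<Rightarrow>\<^sub>L 'h) set \<Rightarrow> ('h \<Rightarrow>\<^sub>L 'h) set"
  where "op_center \<A> = {S\<in>\<A>. \<forall>T\<in>\<A>. S o\<^sub>L T = T o\<^sub>L S}"

definition factor :: "('h::chilbert_space \<Rightarrow>\<^sub>L 'h) set \<Rightarrow> bool"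
  where "factor \<A> \<longleftrightarrow>
    von_neumann_algebra \<A> \<and> op_center \<A> = range (\<lambda>c. scaleC_op c id_blinfun)"

definition op_unit_interval :: "('h::chilbert_space \<Rightarrow>\<^sub>L 'h) set"
  where "op_unit_interval = {T. positive_op T \<and> op_le T id_blinfun}"

definition effects :: "('h::chilbert_space \<Rightarrow>\<^sub>L 'h) set \<Rightarrow> ('h \<Rightarrow>\<^sub>L 'h) set"
  where "effects \<A> = op_unit_interval \<inter> \<A>"

definition affine_fun_on :: "'a::real_vector set \<Rightarrow> ('a \<Rightarrow> 'b::real_vector) \<Rightarrow> bool"
  where "affine_fun_on C \<psi> \<longleftrightarrow>
    (\<forall>x\<in>C. \<forall>y\<in>C. \<forall>l\<in>{0..1::real}.
       \<psi> (l *\<^sub>R x + (1 - l) *\<^sub>R y) = l *\<^sub>R \<psi> x + (1 - l) *\<^sub>R \<psi> y)"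

definition star_linear_bij ::
    "('h::chilbert_space \<Rightarrow>\<^sub>L 'h) set \<Rightarrow> (('h \<Rightarrow>\<^sub>L 'h) \<Rightarrow> ('h \<Rightarrow>\<^sub>L 'h)) \<Rightarrow> bool"
  where "star_linear_bij \<A> \<Phi> \<longleftrightarrow>
    bij_betw \<Phi> \<A> \<A> \<and>
    (\<forall>S\<in>\<A>. \<forall>T\<in>\<A>. \<Phi> (S + T) = \<Phi> S + \<Phi> T) \<and>
    (\<forall>c. \<forall>T\<in>\<A>. \<Phi> (scaleC_op c T) = scaleC_op c (\<Phi> T)) \<and>
    (\<forall>T\<in>\<A>. \<Phi> (adj T) = adj (\<Phi> T))"

definition star_automorphism ::
    "('h::chilbert_space \<Rightarrow>\<^sub>L 'h) set \<Rightarrow> (('h \<Rightarrow>\<^sub>L 'h) \<Rightarrow> ('h \<Rightarrow>\<^sub>L 'h)) \<Rightarrow> bool"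
  where "star_automorphism \<A> \<Phi> \<longleftrightarrow>
    star_linear_bij \<A> \<Phi> \<and> (\<forall>S\<in>\<A>. \<forall>T\<in>\<A>. \<Phi> (S o\<^sub>L T) = \<Phi> S o\<^sub>L \<Phi> T)"

definition star_antiautomorphism ::
    "('h::chilbert_space \<Rightarrow>\<^sub>L 'h) set \<Rightarrow> (('h \<Rightarrow>\<^sub>L 'h) \<Rightarrow> ('h \<Rightarrow>\<^sub>L 'h)) \<Rightarrow> bool"
  where "star_antiautomorphism \<A> \<Phi> \<longleftrightarrow>
    star_linear_bij \<A> \<Phi> \<and> (\<forall>S\<in>\<A>. \<forall>T\<in>\<A>. \<Phi> (T o\<^sub>L S) = \<Phi> S o\<^sub>L \<Phi> T)"

end

theory Submission
  imports Defs
begin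

text \<open>
  Because every self-adjoint element of the algebra is a real multiple of a difference of two
  effects, an affine bijection \<open>\<phi>\<close> of the effects has a real-linear extension to the
  self-adjoint part (\<open>affine_extension\<close>, \<open>effect_bijection_extension\<close>).

  The decisive point is that \<open>P = \<phi>(0)\<close> is \<open>0\<close> or \<open>I\<close> (\<open>image_of_zero_trivial\<close>).  The cone
  generated by the effects at \<open>0\<close> is the positive cone, which is closed and contains no line, so
  the closed cone generated at \<open>P\<close>, its linear image, contains no line either.  But for skew-adjoint \<open>K\<close> the effects
  \<open>(I + t K) P (I - t K) / (1 + t\<^sup>2 \<parallel>K\<parallel>\<^sup>2)\<close> leave \<open>P\<close> with velocity \<open>[K, P]\<close>, and replacing \<open>K\<close>
  by \<open>- K\<close> reverses the velocity.  Hence \<open>[K, P] = 0\<close> for all such \<open>K\<close>, so \<open>P\<close> is central,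
  hence scalar, and being extreme among the effects it is \<open>0\<close> or \<open>I\<close>.  Passing from \<open>\<phi>\<close> to
  \<open>I - \<phi>\<close> if necessary, one may assume \<open>\<phi>(0) = 0\<close>.

  Then the linear extension and its inverse are unital and positive.  Both therefore satisfy
  Kadison's inequality \<open>L(X)\<^sup>2 \<le> L(X\<^sup>2)\<close> for effects \<open>X\<close>, which makes the extension preserve squares
  (\<open>unital_order_isomorphism_square\<close>).  The inequality usually rests on the spectral theorem;
  here the positive partitions of unity in the algebra generated by \<open>X\<close> are provided by the
  Bernstein polynomials (\<open>Kadison_inequality\<close>).  Complexification turns the extension into a
  Jordan star-isomorphism of the factor.

  A factor is a prime algebra: the central projection attached to a nonzero star-closed ideal is
  a strong limit of elements of the ideal, and so it must be \<open>I\<close> (\<open>factor_ideal_kernel\<close>,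
  \<open>factor_prime\<close>).  A Jordan homomorphism onto a prime algebra is multiplicative or
  antimultiplicative, by the ring-theoretic argument of Herstein and Smiley
  (\<open>Jordan_onto_prime\<close>).
\<close>

section \<open>Operator arithmetic\<close>

lemmas blinfun_compose_add = bounded_bilinear.add_left[OF bounded_bilinear_blinfun_compose]
  bounded_bilinear.add_right[OF bounded_bilinear_blinfun_compose]

lemmas blinfun_compose_diff = bounded_bilinear.diff_left[OF bounded_bilinear_blinfun_compose]
  bounded_bilinear.diff_right[OF bounded_bilinear_blinfun_compose]

lemmas blinfun_compose_minus = bounded_bilinear.minus_left[OF bounded_bilinear_blinfun_compose]
  bounded_bilinear.minus_right[OF bounded_bilinear_blinfun_compose]

lemmas blinfun_compose_scaleR = bounded_bilinear.scaleR_left[OF bounded_bilinear_blinfun_compose]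
  bounded_bilinear.scaleR_right[OF bounded_bilinear_blinfun_compose]

lemma blinfun_compose_assoc: "(R o\<^sub>L S) o\<^sub>L T = R o\<^sub>L (S o\<^sub>L T)"
  by (rule blinfun_eqI) simp

lemma blinfun_compose_id [simp]: "id_blinfun o\<^sub>L T = T" "T o\<^sub>L id_blinfun = T"
  by (rule blinfun_eqI, simp)+

lemmas blinfun_compose_simps = blinfun_compose_add blinfun_compose_diff blinfun_compose_minus
  blinfun_compose_scaleR blinfun_compose_assoc

lemma scaleC_zero_right [simp]: "c *\<^sub>C (0::'h::chilbert_space) = 0"
  using norm_scaleC[of c "0::'h"] by simp

lemma scaleC_minus_right: "c *\<^sub>C (- x) = - (c *\<^sub>C (x::'h::chilbert_space))"
  using scaleC_add_right[of c x "- x"] by (simp add: add_eq_0_iff)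

lemma scaleC_diff_right: "c *\<^sub>C (x - y) = c *\<^sub>C x - c *\<^sub>C (y::'h::chilbert_space)"
  using scaleC_add_right[of c x "- y"] by (simp add: scaleC_minus_right)

lemma scaleC_scaleR: "c *\<^sub>C (r *\<^sub>R x) = r *\<^sub>R (c *\<^sub>C (x::'h::chilbert_space))"
  by (simp add: scaleC_of_real[symmetric] scaleC_scaleC mult.commute)

lemma scaleC_minus_one: "(- 1) *\<^sub>C x = - (x::'h::chilbert_space)"
  using scaleC_of_real[of "- 1" x] by simp

lemma scaleC_minus_left: "(- c) *\<^sub>C x = - (c *\<^sub>C (x::'h::chilbert_space))"
  using scaleC_scaleC[of "- 1" c x] by (simp add: scaleC_minus_one)

lemma cinner_scaleC_right: "cinner x (c *\<^sub>C y) = cnj c * cinner x (y::'h::chilbert_space)"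
  by (metis cinner_commute cinner_scaleC_left complex_cnj_mult)

lemma inner_scaleC_left: "inner (c *\<^sub>C x) y = inner x (cnj c *\<^sub>C (y::'h::chilbert_space))"
  by (simp add: Re_cinner[symmetric] cinner_scaleC_left cinner_scaleC_right)

lemma scaleC_op_apply [simp]: "scaleC_op c T x = c *\<^sub>C T x"
  by (simp add: scaleC_op.rep_eq)

lemma scaleC_op_add: "scaleC_op c (S + T) = scaleC_op c S + scaleC_op c T"
  by (rule blinfun_eqI) (simp add: plus_blinfun.rep_eq scaleC_add_right)

lemma scaleC_op_scaleC_op: "scaleC_op c (scaleC_op d T) = scaleC_op (c * d) T"
  by (rule blinfun_eqI) (simp add: scaleC_scaleC)

lemma scaleC_op_of_real: "scaleC_op (complex_of_real r) T = r *\<^sub>R T"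
  by (rule blinfun_eqI) (simp add: scaleC_of_real scaleR_blinfun.rep_eq)

lemma bounded_opsD: "T \<in> bounded_ops \<Longrightarrow> T (c *\<^sub>C x) = c *\<^sub>C T x"
  by (simp add: bounded_ops_def)

lemma inner_adj: "T \<in> bounded_ops \<Longrightarrow> inner (T x) y = inner x (adj T y)"
  by (metis Re_cinner cinner_adj)

lemma adj_eqI:
  assumes "T \<in> bounded_ops" "\<And>x y. inner (T x) y = inner x (blinfun_apply S y)"
  shows "adj T = S"
proof (rule blinfun_eqI)
  fix y
  have "inner x (adj T y) = inner x (S y)" for x
    using assms inner_adj by metis
  then show "adj T y = S y" by (metis vector_eq_rdot inner_commute)
qed

lemma adj_bounded_ops: "adj T \<in> bounded_ops" if T: "T \<in> bounded_ops"
proof -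
  have "adj T (c *\<^sub>C y) = c *\<^sub>C adj T y" for c y
  proof -
    have "inner x (adj T (c *\<^sub>C y)) = inner x (c *\<^sub>C adj T y)" for x
    proof -
      have "inner x (adj T (c *\<^sub>C y)) = inner (T x) (c *\<^sub>C y)"
        by (simp add: inner_adj T)
      also have "\<dots> = inner (cnj c *\<^sub>C T x) y"
        by (simp add: inner_scaleC_left)
      also have "\<dots> = inner (T (cnj c *\<^sub>C x)) y"
        by (simp add: bounded_opsD T)
      also have "\<dots> = inner x (c *\<^sub>C adj T y)"
        by (simp add: inner_adj T inner_scaleC_left)
      finally show ?thesis .
    qed
    then show ?thesis by (metis vector_eq_rdot inner_commute)
  qed
  then show ?thesis by (simp add: bounded_ops_def)
qed

lemma bounded_ops_add: "S \<in> bounded_ops \<Longrightarrow> T \<in> bounded_ops \<Longrightarrow> S + T \<in> bounded_ops"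
  by (simp add: bounded_ops_def plus_blinfun.rep_eq scaleC_add_right)

lemma bounded_ops_scaleC_op: "T \<in> bounded_ops \<Longrightarrow> scaleC_op c T \<in> bounded_ops"
  by (simp add: bounded_ops_def scaleC_scaleC mult.commute)

lemma bounded_ops_compose: "S \<in> bounded_ops \<Longrightarrow> T \<in> bounded_ops \<Longrightarrow> S o\<^sub>L T \<in> bounded_ops"
  by (simp add: bounded_ops_def)

lemma adj_adj [simp]: "T \<in> bounded_ops \<Longrightarrow> adj (adj T) = T"
  by (rule adj_eqI) (metis adj_bounded_ops inner_adj inner_commute)+

lemma adj_add: "S \<in> bounded_ops \<Longrightarrow> T \<in> bounded_ops \<Longrightarrow> adj (S + T) = adj S + adj T"
  by (rule adj_eqI)
    (simp_all add: bounded_ops_add plus_blinfun.rep_eq inner_add_left inner_add_right inner_adj)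

lemma adj_scaleC_op: "T \<in> bounded_ops \<Longrightarrow> adj (scaleC_op c T) = scaleC_op (cnj c) (adj T)"
  by (rule adj_eqI)
    (simp_all add: bounded_ops_scaleC_op inner_scaleC_left inner_adj bounded_opsD adj_bounded_ops)

lemma adj_compose: "S \<in> bounded_ops \<Longrightarrow> T \<in> bounded_ops \<Longrightarrow> adj (S o\<^sub>L T) = adj T o\<^sub>L adj S"
  by (rule adj_eqI) (simp_all add: bounded_ops_compose inner_adj)

lemma id_bounded_ops: "id_blinfun \<in> bounded_ops"
  by (simp add: bounded_ops_def)

lemma adj_id [simp]: "adj id_blinfun = id_blinfun"
  by (rule adj_eqI) (simp_all add: id_bounded_ops)

lemma adj_scaleR: "T \<in> bounded_ops \<Longrightarrow> adj (r *\<^sub>R T) = r *\<^sub>R adj T"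
  using adj_scaleC_op[of T "complex_of_real r"] by (simp add: scaleC_op_of_real)

text \<open>Positivity is tested on the real inner product; on self-adjoint operators this is
  the usual order.\<close>

definition nonneg :: "('h::chilbert_space \<Rightarrow>\<^sub>L 'h) \<Rightarrow> bool"
  where "nonneg T \<longleftrightarrow> (\<forall>x. 0 \<le> inner (T x) x)"

lemma nonneg_add: "nonneg S \<Longrightarrow> nonneg T \<Longrightarrow> nonneg (S + T)"
  by (simp add: nonneg_def plus_blinfun.rep_eq inner_add_left)

lemma nonneg_scaleR: "0 \<le> r \<Longrightarrow> nonneg T \<Longrightarrow> nonneg (r *\<^sub>R T)"
  by (simp add: nonneg_def scaleR_blinfun.rep_eq)

lemma nonneg_id: "nonneg id_blinfun"
  by (simp add: nonneg_def)

lemma nonneg_0: "nonneg 0"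
  by (simp add: nonneg_def)

lemma nonneg_conjugate:
  assumes "R \<in> bounded_ops" "nonneg T"
  shows "nonneg (adj R o\<^sub>L (T o\<^sub>L R))"
  using assms by (simp add: nonneg_def inner_adj[OF adj_bounded_ops] )

text \<open>By polarization, a self-adjoint operator is determined by its quadratic form, so the order is
  antisymmetric.\<close>

lemma nonneg_antisym:
  assumes T: "T \<in> bounded_ops" "adj T = T" and "nonneg T" "nonneg (- T)"
  shows "T = 0"
proof (rule blinfun_eqI)
  fix x
  have q: "inner (T v) v = 0" for v
    using assms(3,4) by (simp add: nonneg_def uminus_blinfun.rep_eq order_antisym)
  have "inner (T x) y = 0" for y
    using q[of "x + y"] q[of x] q[of y] inner_adj[OF T(1), of y x]
    by (simp add: T(2) inner_add_left inner_add_right blinfun.add_right inner_commute)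
  from this[of "T x"] show "T x = (0::'a \<Rightarrow>\<^sub>L 'a) x" by simp
qed

section \<open>Self-adjoint parts of star-algebras\<close>

definition self_adjoint_part :: "('h::chilbert_space \<Rightarrow>\<^sub>L 'h) set \<Rightarrow> ('h \<Rightarrow>\<^sub>L 'h) set"
  where "self_adjoint_part A = {X \<in> A. adj X = X}"

locale operator_algebra =
  fixes A :: "('h::chilbert_space \<Rightarrow>\<^sub>L 'h) set"
  assumes bounded: "T \<in> A \<Longrightarrow> T \<in> bounded_ops"
    and id_closed: "id_blinfun \<in> A"
    and add_closed: "S \<in> A \<Longrightarrow> T \<in> A \<Longrightarrow> S + T \<in> A"
    and scaleC_closed: "T \<in> A \<Longrightarrow> scaleC_op c T \<in> A"
    and compose_closed: "S \<in> A \<Longrightarrow> T \<in> A \<Longrightarrow> S o\<^sub>L T \<in> A"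
    and adj_closed: "T \<in> A \<Longrightarrow> adj T \<in> A"
begin

abbreviation "sa \<equiv> self_adjoint_part A"

lemma scaleR_closed: "T \<in> A \<Longrightarrow> r *\<^sub>R T \<in> A"
  using scaleC_closed[of T "complex_of_real r"] by (simp add: scaleC_op_of_real)

lemma zero_closed: "0 \<in> A"
  using scaleR_closed[OF id_closed, of 0] by simp

lemma minus_closed: "T \<in> A \<Longrightarrow> - T \<in> A"
  using scaleR_closed[of T "- 1"] by simp

lemma diff_closed: "S \<in> A \<Longrightarrow> T \<in> A \<Longrightarrow> S - T \<in> A"
  using add_closed[of S "- T"] minus_closed by simp

lemmas closed = id_closed add_closed scaleC_closed compose_closed adj_closed scaleR_closed
  zero_closed minus_closed diff_closed

lemma adj_minus: "T \<in> A \<Longrightarrow> adj (- T) = - adj T"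
  using adj_scaleR[of T "- 1"] bounded by simp

lemma adj_diff: "S \<in> A \<Longrightarrow> T \<in> A \<Longrightarrow> adj (S - T) = adj S - adj T"
  using adj_add[of S "- T"] adj_minus bounded minus_closed by simp

lemma adj_zero: "adj 0 = (0 :: 'h \<Rightarrow>\<^sub>L 'h)"
  using adj_diff[OF id_closed id_closed] by simp

lemmas adj_simps = adj_add[OF bounded bounded] adj_scaleR[OF bounded] adj_compose[OF bounded bounded]
  adj_minus adj_diff adj_zero adj_scaleC_op[OF bounded] adj_adj[OF bounded]

lemma sa_iff: "X \<in> sa \<longleftrightarrow> X \<in> A \<and> adj X = X"
  by (simp add: self_adjoint_part_def)

lemma saD: "X \<in> sa \<Longrightarrow> X \<in> A" "X \<in> sa \<Longrightarrow> adj X = X"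
  by (simp_all add: sa_iff)

lemma sa_closed:
  "id_blinfun \<in> sa" "0 \<in> sa" "X \<in> sa \<Longrightarrow> Y \<in> sa \<Longrightarrow> X + Y \<in> sa"
  "X \<in> sa \<Longrightarrow> Y \<in> sa \<Longrightarrow> X - Y \<in> sa" "X \<in> sa \<Longrightarrow> - X \<in> sa" "X \<in> sa \<Longrightarrow> r *\<^sub>R X \<in> sa"
  by (simp_all add: sa_iff closed adj_simps)

lemma sa_symmetric: "X \<in> sa \<Longrightarrow> inner (X x) y = inner x (X y)"
  using inner_adj[OF bounded] saD by metis

lemma sa_square: "X \<in> sa \<Longrightarrow> X o\<^sub>L X \<in> sa"
  by (simp add: sa_iff closed adj_simps)

lemma sa_antisym: "X \<in> sa \<Longrightarrow> nonneg X \<Longrightarrow> nonneg (- X) \<Longrightarrow> X = 0"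
  using nonneg_antisym bounded saD by blast

lemma sa_order_antisym: "X \<in> sa \<Longrightarrow> Y \<in> sa \<Longrightarrow> nonneg (X - Y) \<Longrightarrow> nonneg (Y - X) \<Longrightarrow> X = Y"
  using sa_antisym[of "X - Y"] by (simp add: sa_closed)

lemma effects_iff: "T \<in> effects A \<longleftrightarrow> T \<in> sa \<and> nonneg T \<and> nonneg (id_blinfun - T)"
proof -
  have *: "positive_op X \<longleftrightarrow> nonneg X" if X: "X \<in> sa" for X
  proof -
    have "cinner (X x) x = cnj (cinner (X x) x)" for x
      using cinner_adj[OF bounded[OF saD(1)[OF X]], of x x] saD(2)[OF X] cinner_commute by metis
    then have "Im (cinner (X x) x) = 0" for x
      by (metis complex_cnj complex_surj complex.sel(2) neg_equal_zero)
    then show ?thesis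
      using saD(1)[OF X] bounded
      by (auto simp: positive_op_def nonneg_def complex_nonneg_Reals_iff Re_cinner)
  qed
  have "selfadjoint_op T \<and> T \<in> A \<longleftrightarrow> T \<in> sa"
    using bounded by (auto simp: selfadjoint_op_def sa_iff)
  moreover have "selfadjoint_op (id_blinfun :: 'h \<Rightarrow>\<^sub>L 'h)"
    by (simp add: selfadjoint_op_def id_bounded_ops)
  ultimately have "T \<in> effects A \<longleftrightarrow> T \<in> sa \<and> positive_op T \<and> positive_op (id_blinfun - T)"
    by (auto simp: effects_def op_unit_interval_def op_le_def)
  then show ?thesis using * sa_closed by blast
qed

lemma effectsD:
  assumes "T \<in> effects A" shows "T \<in> sa" "nonneg T" "nonneg (id_blinfun - T)"
  using assms by (simp_all add: effects_iff)

lemma effects_complement: "T \<in> effects A \<Longrightarrow> id_blinfun - T \<in> effects A"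
  by (simp add: effects_iff sa_closed)

lemma zero_effect: "0 \<in> effects A" and id_effect: "id_blinfun \<in> effects A"
  by (simp_all add: effects_iff sa_closed nonneg_0 nonneg_id)

lemma effects_convex:
  assumes "a \<in> effects A" "b \<in> effects A" "l \<in> {0..1::real}"
  shows "l *\<^sub>R a + (1 - l) *\<^sub>R b \<in> effects A"
proof -
  have "id_blinfun - (l *\<^sub>R a + (1 - l) *\<^sub>R b) = l *\<^sub>R (id_blinfun - a) + (1 - l) *\<^sub>R (id_blinfun - b)"
    by (simp add: algebra_simps)
  then show ?thesis
    using assms by (auto simp: effects_iff sa_closed intro!: nonneg_add nonneg_scaleR)
qed

lemma nonneg_norm_bound: "r \<ge> norm X \<Longrightarrow> nonneg (r *\<^sub>R id_blinfun - X)"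
proof -
  assume r: "r \<ge> norm X"
  have "inner (X x) x \<le> r * inner x x" for x
  proof -
    have "inner (X x) x \<le> norm (X x) * norm x" by (rule norm_cauchy_schwarz)
    also have "\<dots> \<le> norm X * norm x * norm x"
      by (intro mult_right_mono norm_blinfun) simp
    also have "\<dots> \<le> r * inner x x"
      using r by (simp add: dot_square_norm power2_eq_square mult.assoc mult_right_mono)
    finally show ?thesis .
  qed
  then show ?thesis
    by (simp add: nonneg_def minus_blinfun.rep_eq scaleR_blinfun.rep_eq inner_diff_left)
qed

text \<open>A self-adjoint \<open>X\<close> of norm at most \<open>r\<close> becomes an effect after the substitution
  \<open>X \<mapsto> X / (2 r) + I / 2\<close>, so effects span the self-adjoint part.\<close>

lemma sa_affine_effect:
  assumes X: "X \<in> sa"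
  obtains r a where "0 < r" "a \<in> effects A" "X = r *\<^sub>R (2 *\<^sub>R a - id_blinfun)"
proof -
  \<comment> \<open>The summand 1 keeps \<open>r\<close> positive when \<open>X = 0\<close>.\<close>
  define r where "r = norm X + 1"
  have r: "r > 0" "r \<ge> norm X" "r \<ge> norm (- X)" by (auto simp: r_def add_nonneg_pos)
  define a where "a = (1 / (2 * r)) *\<^sub>R (r *\<^sub>R id_blinfun - (- X))"
  have a': "id_blinfun - a = (1 / (2 * r)) *\<^sub>R (r *\<^sub>R id_blinfun - X)"
  proof -
    have "(2 * r) *\<^sub>R a = r *\<^sub>R id_blinfun + X" using r(1) by (simp add: a_def)
    moreover have "(2 * r) *\<^sub>R (id_blinfun :: 'h \<Rightarrow>\<^sub>L 'h) = r *\<^sub>R id_blinfun + r *\<^sub>R id_blinfun"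
      by (simp add: scaleR_add_left[symmetric])
    ultimately have "(2 * r) *\<^sub>R (id_blinfun - a) = r *\<^sub>R id_blinfun - X"
      by (simp only: scaleR_diff_right) simp
    then have "(1 / (2 * r)) *\<^sub>R ((2 * r) *\<^sub>R (id_blinfun - a)) = (1 / (2 * r)) *\<^sub>R (r *\<^sub>R id_blinfun - X)"
      by simp
    then show ?thesis using r(1) by simp
  qed
  have "a \<in> effects A"
    unfolding effects_iff a' using r X
    by (auto simp: a_def sa_closed intro!: nonneg_scaleR nonneg_norm_bound[of _ r, simplified]
        nonneg_norm_bound[of "- X" r, simplified])
  moreover have "X = r *\<^sub>R (2 *\<^sub>R a - id_blinfun)"
    using r by (simp add: a_def algebra_simps)
  ultimately show thesis using that r by blast
qed

end

section \<open>Linear extension of affine maps\<close>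

text \<open>An affine map extends to the differences of points of its domain because the value at
  \<open>r (a - b) = s (c - d)\<close> does not depend on the representation: dividing
  \<open>r a + s d = s c + r b\<close> by \<open>r + s\<close> equates two convex combinations.\<close>

lemma affine_extension:
  fixes \<phi> :: "'a::real_vector \<Rightarrow> 'b::real_vector"
  assumes aff: "affine_fun_on C \<phi>"
    and C: "\<And>a b l. a \<in> C \<Longrightarrow> b \<in> C \<Longrightarrow> l \<in> {0..1::real} \<Longrightarrow> l *\<^sub>R a + (1 - l) *\<^sub>R b \<in> C"
    and V: "\<And>v. v \<in> V \<Longrightarrow> \<exists>r>0. \<exists>a\<in>C. \<exists>b\<in>C. v = r *\<^sub>R (a - b)"
  obtains \<psi> where "\<And>a b. a \<in> C \<Longrightarrow> b \<in> C \<Longrightarrow> \<psi> (a - b) = \<phi> a - \<phi> b"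
    and "\<And>v w. v \<in> V \<Longrightarrow> w \<in> V \<Longrightarrow> \<psi> (v + w) = \<psi> v + \<psi> w"
    and "\<And>r v. v \<in> V \<Longrightarrow> \<psi> (r *\<^sub>R v) = r *\<^sub>R \<psi> v"
proof -
  have conv: "(1 / (r + s)) *\<^sub>R (r *\<^sub>R a + s *\<^sub>R d) \<in> C \<and>
      r *\<^sub>R \<phi> a + s *\<^sub>R \<phi> d = (r + s) *\<^sub>R \<phi> ((1 / (r + s)) *\<^sub>R (r *\<^sub>R a + s *\<^sub>R d))"
    if "a \<in> C" "d \<in> C" "0 < r" "0 < s" for a d and r s :: real
  proof -
    define l where "l = r / (r + s)"
    have l: "l \<in> {0..1}" "1 - l = s / (r + s)" "(r + s) * l = r" "(r + s) * (1 - l) = s"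
      using that(3,4) by (simp_all add: l_def field_simps)
    have eq: "(1 / (r + s)) *\<^sub>R (r *\<^sub>R a + s *\<^sub>R d) = l *\<^sub>R a + (1 - l) *\<^sub>R d"
      unfolding l(2) by (simp add: l_def scaleR_add_right divide_inverse mult.commute)
    have "\<phi> (l *\<^sub>R a + (1 - l) *\<^sub>R d) = l *\<^sub>R \<phi> a + (1 - l) *\<^sub>R \<phi> d"
      using aff that(1,2) l(1) unfolding affine_fun_on_def by blast
    then have "(r + s) *\<^sub>R \<phi> (l *\<^sub>R a + (1 - l) *\<^sub>R d) = r *\<^sub>R \<phi> a + s *\<^sub>R \<phi> d"
      by (simp only: scaleR_add_right scaleR_scaleR l(3,4))
    then show ?thesis
      unfolding eq using C that l(1) by simp
  qed
  have welldef: "r *\<^sub>R (\<phi> a - \<phi> b) = s *\<^sub>R (\<phi> c - \<phi> d)"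
    if "r *\<^sub>R (a - b) = s *\<^sub>R (c - d)" "a \<in> C" "b \<in> C" "c \<in> C" "d \<in> C" "0 < r" "0 < s"
    for a b c d and r s :: real
  proof -
    have "r *\<^sub>R a + s *\<^sub>R d = r *\<^sub>R b + s *\<^sub>R c"
      using that(1) by (simp add: algebra_simps)
    then have "r *\<^sub>R \<phi> a + s *\<^sub>R \<phi> d = r *\<^sub>R \<phi> b + s *\<^sub>R \<phi> c"
      using conv[of a d r s] conv[of b c r s] that by simp
    then show ?thesis by (simp add: algebra_simps)
  qed
  define \<psi> where "\<psi> v = (SOME w. \<exists>r>0. \<exists>a\<in>C. \<exists>b\<in>C. v = r *\<^sub>R (a - b) \<and> w = r *\<^sub>R (\<phi> a - \<phi> b))" for v
  have \<psi>: "\<psi> (r *\<^sub>R (a - b)) = r *\<^sub>R (\<phi> a - \<phi> b)" if "a \<in> C" "b \<in> C" "0 < r" for a b and r :: real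
    unfolding \<psi>_def
  proof (rule some_equality)
    show "\<exists>r'>0. \<exists>a'\<in>C. \<exists>b'\<in>C. r *\<^sub>R (a - b) = r' *\<^sub>R (a' - b') \<and> r *\<^sub>R (\<phi> a - \<phi> b) = r' *\<^sub>R (\<phi> a' - \<phi> b')"
      using that by blast
    show "w = r *\<^sub>R (\<phi> a - \<phi> b)"
      if "\<exists>s>0. \<exists>c\<in>C. \<exists>d\<in>C. r *\<^sub>R (a - b) = s *\<^sub>R (c - d) \<and> w = s *\<^sub>R (\<phi> c - \<phi> d)" for w
      using that welldef[of r a b] \<open>a \<in> C\<close> \<open>b \<in> C\<close> \<open>0 < r\<close> by (elim exE conjE bexE) metis
  qed
  show thesis
  proof (rule that[of \<psi>])
    show "\<psi> (a - b) = \<phi> a - \<phi> b" if "a \<in> C" "b \<in> C" for a b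
      using \<psi>[OF that, of 1] by simp
    show "\<psi> (v + w) = \<psi> v + \<psi> w" if vw: "v \<in> V" "w \<in> V" for v w
    proof -
      obtain r a b s c d where *: "r > 0" "s > 0" "a \<in> C" "b \<in> C" "c \<in> C" "d \<in> C"
        "v = r *\<^sub>R (a - b)" "w = s *\<^sub>R (c - d)" using V vw by metis
      define m where "m x y = (1 / (r + s)) *\<^sub>R (r *\<^sub>R x + s *\<^sub>R y)" for x y :: 'a
      have "v + w = (r + s) *\<^sub>R (m a c - m b d)"
        using * by (simp add: m_def scaleR_diff_right)
      moreover have m: "m a c \<in> C" "m b d \<in> C"
        "r *\<^sub>R \<phi> a + s *\<^sub>R \<phi> c = (r + s) *\<^sub>R \<phi> (m a c)" "r *\<^sub>R \<phi> b + s *\<^sub>R \<phi> d = (r + s) *\<^sub>R \<phi> (m b d)"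
        using conv * by (simp_all add: m_def)
      ultimately have "\<psi> (v + w) = (r + s) *\<^sub>R (\<phi> (m a c) - \<phi> (m b d))"
        using \<psi> * by simp
      also have "\<dots> = r *\<^sub>R (\<phi> a - \<phi> b) + s *\<^sub>R (\<phi> c - \<phi> d)"
        by (simp add: scaleR_diff_right m(3,4)[symmetric])
      finally show ?thesis using \<psi> * by simp
    qed
    show "\<psi> (r *\<^sub>R v) = r *\<^sub>R \<psi> v" if v: "v \<in> V" for r :: real and v
    proof -
      obtain s a b where *: "s > 0" "a \<in> C" "b \<in> C" "v = s *\<^sub>R (a - b)" using V v by metis
      consider "r > 0" | "r = 0" | "r < 0" by linarith
      then show ?thesis
      proof cases
        case 1
        with * \<psi>[of a b "r * s"] \<psi>[of a b s] show ?thesis by simp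
      next
        case 2
        with \<psi>[of a a 1] * show ?thesis by simp
      next
        case 3
        have "r *\<^sub>R v = (- r * s) *\<^sub>R (b - a)" by (simp add: *(4) scaleR_diff_right)
        then have "\<psi> (r *\<^sub>R v) = (- r * s) *\<^sub>R (\<phi> b - \<phi> a)"
          using \<psi>[of b a "- r * s"] * 3 by (simp add: mult_neg_pos)
        also have "\<dots> = r *\<^sub>R \<psi> v" using \<psi>[of a b s] *(1-3) unfolding *(4) by (simp add: scaleR_diff_right)
        finally show ?thesis .
      qed
    qed
  qed
qed

text \<open>The self-adjoint part is a carrier set and not a type, so real-linearity on it is spelled out.\<close>

locale sa_linear = operator_algebra A for A :: "('h::chilbert_space \<Rightarrow>\<^sub>L 'h) set" +
  fixes L :: "('h \<Rightarrow>\<^sub>L 'h) \<Rightarrow> ('h \<Rightarrow>\<^sub>L 'h)"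
  assumes maps: "X \<in> sa \<Longrightarrow> L X \<in> sa"
    and add: "X \<in> sa \<Longrightarrow> Y \<in> sa \<Longrightarrow> L (X + Y) = L X + L Y"
    and scale: "X \<in> sa \<Longrightarrow> L (r *\<^sub>R X) = r *\<^sub>R L X"
begin

lemma zero: "L 0 = 0"
  using scale[OF sa_closed(2), of 0] by simp

lemma minus: "X \<in> sa \<Longrightarrow> L (- X) = - L X"
  using scale[of X "- 1"] by simp

lemma diff: "X \<in> sa \<Longrightarrow> Y \<in> sa \<Longrightarrow> L (X - Y) = L X - L Y"
  using add[of X "- Y"] minus by (simp add: sa_closed)

end

context operator_algebra
begin

lemma sa_difference_of_effects:
  assumes "X \<in> sa"
  shows "\<exists>r>0. \<exists>a\<in>effects A. \<exists>b\<in>effects A. X = r *\<^sub>R (a - b)"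
proof -
  obtain r a where *: "0 < r" "a \<in> effects A" "X = r *\<^sub>R (2 *\<^sub>R a - id_blinfun)"
    using sa_affine_effect[OF assms] .
  have "X = r *\<^sub>R (a - (id_blinfun - a))" using * by (simp add: scaleR_2)
  then show ?thesis using * effects_complement by blast
qed

lemma effect_map_extension:
  assumes "affine_fun_on (effects A) \<phi>" "\<phi> ` effects A \<subseteq> effects A"
  obtains \<psi> where "sa_linear A \<psi>"
    and "\<And>a b. a \<in> effects A \<Longrightarrow> b \<in> effects A \<Longrightarrow> \<psi> (a - b) = \<phi> a - \<phi> b"
proof -
  obtain \<psi> where \<psi>: "\<And>a b. a \<in> effects A \<Longrightarrow> b \<in> effects A \<Longrightarrow> \<psi> (a - b) = \<phi> a - \<phi> b"
    "\<And>v w. v \<in> sa \<Longrightarrow> w \<in> sa \<Longrightarrow> \<psi> (v + w) = \<psi> v + \<psi> w"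
    "\<And>r v. v \<in> sa \<Longrightarrow> \<psi> (r *\<^sub>R v) = r *\<^sub>R \<psi> v"
    by (rule affine_extension[OF assms(1) effects_convex sa_difference_of_effects, of sa]) blast+
  have "\<psi> X \<in> sa" if X: "X \<in> sa" for X
  proof -
    obtain r a b where *: "a \<in> effects A" "b \<in> effects A" "X = r *\<^sub>R (a - b)"
      using sa_difference_of_effects[OF X] by blast
    then have "\<psi> X = r *\<^sub>R (\<phi> a - \<phi> b)"
      using \<psi>(1,3) sa_closed(4) effectsD(1) by simp
    moreover have "\<phi> a \<in> sa" "\<phi> b \<in> sa" using * assms(2) effectsD(1) by blast+
    ultimately show ?thesis by (simp add: sa_closed)
  qed
  then have "sa_linear A \<psi>" by unfold_locales (use \<psi> in blast)+
  with \<psi>(1) show thesis using that by blast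
qed

lemma affine_inverse:
  assumes "bij_betw \<phi> (effects A) (effects A)" "affine_fun_on (effects A) \<phi>"
  shows "affine_fun_on (effects A) (inv_into (effects A) \<phi>)"
  unfolding affine_fun_on_def
proof (intro ballI)
  fix x y and l :: real assume *: "x \<in> effects A" "y \<in> effects A" "l \<in> {0..1}"
  let ?g = "inv_into (effects A) \<phi>"
  have g: "?g x \<in> effects A" "?g y \<in> effects A" "\<phi> (?g x) = x" "\<phi> (?g y) = y"
    using assms(1) * bij_betw_inv_into_right inv_into_into bij_betw_imp_surj_on by metis+
  have "\<phi> (l *\<^sub>R ?g x + (1 - l) *\<^sub>R ?g y) = l *\<^sub>R x + (1 - l) *\<^sub>R y"
    using assms(2) g * unfolding affine_fun_on_def by metis
  then show "?g (l *\<^sub>R x + (1 - l) *\<^sub>R y) = l *\<^sub>R ?g x + (1 - l) *\<^sub>R ?g y"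
    using effects_convex[OF g(1,2) *(3)] assms(1) bij_betw_inv_into_left by metis
qed

text \<open>The inverse of an affine bijection is affine and extends as well; the two extensions are
  inverse to each other because they are so on differences of effects, which span.\<close>

lemma effect_bijection_extension:
  assumes bij: "bij_betw \<phi> (effects A) (effects A)" and aff: "affine_fun_on (effects A) \<phi>"
  defines "\<eta> \<equiv> inv_into (effects A) \<phi>"
  obtains L M where "sa_linear A L" "sa_linear A M"
    and "\<And>a b. a \<in> effects A \<Longrightarrow> b \<in> effects A \<Longrightarrow> L (a - b) = \<phi> a - \<phi> b"
    and "\<And>a b. a \<in> effects A \<Longrightarrow> b \<in> effects A \<Longrightarrow> M (a - b) = \<eta> a - \<eta> b"
    and "\<And>X. X \<in> sa \<Longrightarrow> L (M X) = X" "\<And>X. X \<in> sa \<Longrightarrow> M (L X) = X"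
proof -
  have bij': "bij_betw \<eta> (effects A) (effects A)" unfolding \<eta>_def using bij_betw_inv_into[OF bij] .
  have aff': "affine_fun_on (effects A) \<eta>" unfolding \<eta>_def by (rule affine_inverse[OF bij aff])
  have in_E: "\<phi> e \<in> effects A" "\<eta> e \<in> effects A" if "e \<in> effects A" for e
    using bij bij' that bij_betw_apply by metis+
  have inv: "\<eta> (\<phi> e) = e" "\<phi> (\<eta> e) = e" if "e \<in> effects A" for e
    unfolding \<eta>_def using bij that bij_betw_inv_into_left bij_betw_inv_into_right by metis+
  obtain L where L: "sa_linear A L"
    "\<And>a b. a \<in> effects A \<Longrightarrow> b \<in> effects A \<Longrightarrow> L (a - b) = \<phi> a - \<phi> b"
    using effect_map_extension[OF aff] in_E(1) by blast
  obtain M where M: "sa_linear A M"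
    "\<And>a b. a \<in> effects A \<Longrightarrow> b \<in> effects A \<Longrightarrow> M (a - b) = \<eta> a - \<eta> b"
    using effect_map_extension[OF aff'] in_E(2) by blast
  interpret L: sa_linear A L by (rule L(1))
  interpret M: sa_linear A M by (rule M(1))
  show thesis
  proof (rule that[OF L(1) M(1) L(2) M(2)])
    fix X assume X: "X \<in> sa"
    obtain r a b where *: "a \<in> effects A" "b \<in> effects A" "X = r *\<^sub>R (a - b)"
      using sa_difference_of_effects[OF X] by blast
    have sa: "c - d \<in> sa" if "c \<in> effects A" "d \<in> effects A" for c d
      using sa_closed(4)[OF effectsD(1) effectsD(1)] that .
    have "L X = r *\<^sub>R (\<phi> a - \<phi> b)" "M X = r *\<^sub>R (\<eta> a - \<eta> b)"
      using sa[OF *(1,2)] L(2)[OF *(1,2)] M(2)[OF *(1,2)] by (simp_all only: *(3) L.scale M.scale)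
    then show "L (M X) = X" "M (L X) = X"
      using sa[OF in_E(1) in_E(1)] sa[OF in_E(2) in_E(2)] L(2)[OF in_E(2) in_E(2)]
        M(2)[OF in_E(1) in_E(1)] inv *(1,2) by (simp_all only: *(3) L.scale M.scale)
  qed
qed

end

section \<open>The image of zero is a trivial projection\<close>

context operator_algebra
begin

text \<open>The quadratic form of the conjugated effect at \<open>x\<close> is at most
  \<open>\<parallel>(I - t K) x\<parallel>\<^sup>2 = \<parallel>x\<parallel>\<^sup>2 + t\<^sup>2 \<parallel>K x\<parallel>\<^sup>2\<close>: the cross term vanishes since the real inner product of
  \<open>K x\<close> and \<open>x\<close> is zero for skew-adjoint \<open>K\<close>.\<close>

lemma conjugated_effect:
  assumes P: "P \<in> effects A" and K: "K \<in> A" "adj K = - K"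
    and c: "c = 1 + (t * norm K)\<^sup>2"
  shows "(1 / c) *\<^sub>R ((id_blinfun + t *\<^sub>R K) o\<^sub>L (P o\<^sub>L (id_blinfun - t *\<^sub>R K))) \<in> effects A"
proof -
  define G where "G = id_blinfun - t *\<^sub>R K"
  have G: "G \<in> A" "adj G = id_blinfun + t *\<^sub>R K"
    using K by (simp_all add: G_def closed adj_simps)
  let ?R = "adj G o\<^sub>L (P o\<^sub>L G)"
  have c0: "c > 0" unfolding c by (simp add: add_pos_nonneg)
  have "nonneg ?R"
    using nonneg_conjugate[OF bounded[OF G(1)] effectsD(2)[OF P]] .
  moreover have "nonneg (c *\<^sub>R id_blinfun - ?R)"
  proof -
    have "inner (?R x) x \<le> c * inner x x" for x
    proof -
      have "inner (?R x) x = inner (P (G x)) (G x)"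
        using inner_adj[OF adj_bounded_ops[OF bounded[OF G(1)]]] by (simp add: bounded[OF G(1)])
      also have "\<dots> \<le> inner (G x) (G x)"
        using effectsD(3)[OF P] by (simp add: nonneg_def minus_blinfun.rep_eq inner_diff_left)
      also have "\<dots> = inner x x + t\<^sup>2 * inner (K x) (K x)"
      proof -
        have "inner (K x) x = inner x ((- K) x)"
          using inner_adj[OF bounded[OF K(1)], of x x] K(2) by simp
        then have "inner (K x) x = 0"
          by (simp add: uminus_blinfun.rep_eq inner_commute)
        then show ?thesis
          by (simp add: G_def minus_blinfun.rep_eq scaleR_blinfun.rep_eq inner_diff_left
              inner_diff_right inner_commute power2_eq_square)
      qed
      also have "\<dots> \<le> inner x x + t\<^sup>2 * ((norm K)\<^sup>2 * inner x x)"
      proof -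
        have "(norm (K x))\<^sup>2 \<le> (norm K * norm x)\<^sup>2"
          by (intro power_mono norm_blinfun) simp
        then show ?thesis
          by (simp add: dot_square_norm power_mult_distrib mult_left_mono)
      qed
      also have "\<dots> = c * inner x x"
        by (simp add: c power_mult_distrib algebra_simps)
      finally show ?thesis .
    qed
    then show ?thesis
      by (simp add: nonneg_def minus_blinfun.rep_eq scaleR_blinfun.rep_eq inner_diff_left)
  qed
  then have "nonneg ((1 / c) *\<^sub>R (c *\<^sub>R id_blinfun - ?R))"
    using c0 by (intro nonneg_scaleR) simp_all
  then have "nonneg (id_blinfun - (1 / c) *\<^sub>R ?R)"
    using c0 by (simp add: scaleR_diff_right)
  moreover have "?R \<in> sa"
    using G(1) effectsD(1)[OF P]
    by (simp add: sa_iff closed adj_compose bounded blinfun_compose_assoc)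
  ultimately show ?thesis
    using c0 unfolding effects_iff G(2)[symmetric] G_def[symmetric]
    by (simp add: sa_closed nonneg_scaleR)
qed

text \<open>Conjugation by \<open>I - t K\<close> with \<open>K\<close> skew-adjoint, renormalized, moves an effect \<open>P\<close> along a
  curve of effects with velocity \<open>[K, P]\<close> at \<open>t = 0\<close>.  A linear map that is nonnegative on
  \<open>e - P\<close> for every effect \<open>e\<close> is therefore nonnegative on that velocity.\<close>

lemma nonneg_commutator:
  assumes L: "sa_linear A L" and P: "P \<in> effects A"
    and pos: "\<And>e. e \<in> effects A \<Longrightarrow> nonneg (L (e - P))"
    and K: "K \<in> A" "adj K = - K"
  shows "nonneg (L ((K o\<^sub>L P) - (P o\<^sub>L K)))"
proof -
  interpret L: sa_linear A L by fact
  define C where "C = (K o\<^sub>L P) - (P o\<^sub>L K)"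
  define D where "D = (K o\<^sub>L (P o\<^sub>L K)) + (norm K)\<^sup>2 *\<^sub>R P"
  have P': "P \<in> A" "adj P = P" using effectsD(1)[OF P] by (simp_all add: sa_iff)
  have CD: "C \<in> sa" "D \<in> sa"
    using K P' by (simp_all add: sa_iff C_def D_def closed adj_simps blinfun_compose_simps)
  have bound: "t * inner (L D x) x \<le> inner (L C x) x" if t: "t > 0" for t x
  proof -
    define c where "c = 1 + (t * norm K)\<^sup>2"
    define R where "R = (1 / c) *\<^sub>R ((id_blinfun + t *\<^sub>R K) o\<^sub>L (P o\<^sub>L (id_blinfun - t *\<^sub>R K)))"
    have R: "R \<in> effects A"
      unfolding R_def using conjugated_effect[OF P K] c_def by simp
    have c0: "c > 0" unfolding c_def by (simp add: add_pos_nonneg)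
    have "c *\<^sub>R R = (id_blinfun + t *\<^sub>R K) o\<^sub>L (P o\<^sub>L (id_blinfun - t *\<^sub>R K))"
      using c0 by (simp add: R_def)
    also have "\<dots> = P + t *\<^sub>R C - t\<^sup>2 *\<^sub>R (K o\<^sub>L (P o\<^sub>L K))"
      by (simp add: C_def blinfun_compose_simps power2_eq_square algebra_simps)
    finally have "c *\<^sub>R (R - P) = t *\<^sub>R C - t\<^sup>2 *\<^sub>R D"
      by (simp add: D_def c_def power_mult_distrib algebra_simps)
    then have "L (t *\<^sub>R C - t\<^sup>2 *\<^sub>R D) = c *\<^sub>R L (R - P)"
      using L.scale[of "R - P" c] effectsD(1) R P sa_closed by metis
    then have "nonneg (t *\<^sub>R L C - t\<^sup>2 *\<^sub>R L D)"
      using pos[OF R] c0 CD by (simp add: L.diff L.scale sa_closed nonneg_scaleR)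
    then have "0 \<le> t * (inner (L C x) x - t * inner (L D x) x)"
      by (simp add: nonneg_def minus_blinfun.rep_eq scaleR_blinfun.rep_eq inner_diff_left
          algebra_simps power2_eq_square)
    then show ?thesis using t by (simp add: zero_le_mult_iff)
  qed
  have "0 \<le> inner (L C x) x" for x
  proof -
    have "((\<lambda>t. t * inner (L D x) x) \<longlongrightarrow> 0 * inner (L D x) x) (at_right 0)"
      by (intro tendsto_intros)
    moreover have "eventually (\<lambda>t. t * inner (L D x) x \<le> inner (L C x) x) (at_right 0)"
      by (rule eventually_mono[OF eventually_at_right_less[of 0]]) (rule bound)
    ultimately show ?thesis
      using tendsto_upperbound[of "\<lambda>t. t * inner (L D x) x" 0 "at_right 0"] by simp
  qed
  then show ?thesis by (simp add: nonneg_def C_def)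
qed

text \<open>The skew-adjoint elements \<open>K = S - S\<^sup>*\<close> and \<open>M = i (S + S\<^sup>*)\<close> recover \<open>S\<close> through
  \<open>2 S = K - i M\<close>.\<close>

lemma central_if_commutes_with_skew:
  assumes P: "P \<in> A" and "\<And>K. K \<in> A \<Longrightarrow> adj K = - K \<Longrightarrow> K o\<^sub>L P = P o\<^sub>L K"
  shows "P \<in> op_center A"
proof -
  have "P o\<^sub>L S = S o\<^sub>L P" if S: "S \<in> A" for S
  proof -
    define K where "K = S - adj S"
    define M where "M = scaleC_op \<i> (S + adj S)"
    have KM: "K \<in> A" "adj K = - K" "M \<in> A" "adj M = - M"
    proof -
      show "adj M = - M"
        using S by (intro blinfun_eqI) (simp add: M_def adj_add bounded adj_closed add_closed
            adj_scaleC_op uminus_blinfun.rep_eq plus_blinfun.rep_eq scaleC_minus_left add.commute)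
    qed (use S in \<open>simp_all add: K_def M_def closed adj_simps\<close>)
    have *: "P (K x) = K (P x)" "P (M x) = M (P x)" for x
      using assms(2)[OF KM(1,2)] assms(2)[OF KM(3,4)] blinfun_apply_blinfun_compose by metis+
    have "2 *\<^sub>R S x = K x - \<i> *\<^sub>C M x" for x
      by (simp add: K_def M_def minus_blinfun.rep_eq plus_blinfun.rep_eq scaleC_scaleC
          scaleC_minus_one scaleR_2)
    then have "2 *\<^sub>R P (S x) = 2 *\<^sub>R S (P x)" for x
      using * by (metis blinfun.diff_right blinfun.scaleR_right bounded_opsD[OF bounded[OF P]])
    then show ?thesis by (intro blinfun_eqI) simp
  qed
  then show ?thesis using P by (simp add: op_center_def)
qed

text \<open>Zero is an extreme point of the effects, hence so is its image, and a scalar effect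
  \<open>\<lambda> I\<close> is extreme only for \<open>\<lambda> \<in> {0, 1}\<close>.  The image is scalar because its velocities
  \<open>[K, P]\<close> and \<open>- [K, P]\<close> both pull back to positive operators.\<close>

lemma image_of_zero_trivial:
  assumes fact: "op_center A = range (\<lambda>c. scaleC_op c id_blinfun)"
    and bij: "bij_betw \<phi> (effects A) (effects A)" and aff: "affine_fun_on (effects A) \<phi>"
  shows "\<phi> 0 = 0 \<or> \<phi> 0 = id_blinfun"
proof -
  define \<eta> where "\<eta> = inv_into (effects A) \<phi>"
  define P where "P = \<phi> 0"
  have \<eta>: "\<eta> ` effects A = effects A" "affine_fun_on (effects A) \<eta>"
    using bij_betw_inv_into[OF bij] affine_inverse[OF bij aff] by (auto simp: \<eta>_def bij_betw_def)
  have \<phi>_in: "\<phi> e \<in> effects A" if "e \<in> effects A" for e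
    using bij that bij_betw_apply by metis
  have \<eta>\<phi>: "\<eta> (\<phi> e) = e" if "e \<in> effects A" for e
    unfolding \<eta>_def using bij that bij_betw_inv_into_left by metis
  have \<eta>_in: "\<eta> e \<in> effects A" if "e \<in> effects A" for e
    using \<eta>(1) that by blast
  have P: "P \<in> effects A" "\<eta> P = 0"
    unfolding P_def using \<phi>_in \<eta>\<phi> zero_effect by blast+
  obtain M L where M: "sa_linear A M" and L: "sa_linear A L"
    "\<And>a b. a \<in> effects A \<Longrightarrow> b \<in> effects A \<Longrightarrow> L (a - b) = \<eta> a - \<eta> b"
    and recover: "\<And>X. X \<in> sa \<Longrightarrow> M (L X) = X"
    using effect_bijection_extension[OF bij aff] unfolding \<eta>_def by metis
  interpret L: sa_linear A L by (rule L(1))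
  interpret M: sa_linear A M by (rule M)
  have pos: "nonneg (L (e - P))" if "e \<in> effects A" for e
    using L(2)[OF that P(1)] P(2) effectsD(2)[OF \<eta>_in[OF that]] by simp
  have comm: "K o\<^sub>L P = P o\<^sub>L K" if K: "K \<in> A" "adj K = - K" for K
  proof -
    define C where "C = (K o\<^sub>L P) - (P o\<^sub>L K)"
    have PA: "P \<in> A" "adj P = P" using effectsD(1)[OF P(1)] by (simp_all add: sa_iff)
    have C: "C \<in> sa" using K PA by (simp add: sa_iff C_def closed adj_simps blinfun_compose_simps)
    have "nonneg (L C)" unfolding C_def by (rule nonneg_commutator[OF L(1) P(1) pos K])
    moreover have "nonneg (L (- C))"
      using nonneg_commutator[OF L(1) P(1) pos, of "- K"] K
      by (simp add: C_def closed adj_minus blinfun_compose_minus)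
    ultimately have "L C = 0" using C L.minus L.maps sa_antisym by metis
    then have "C = 0" using recover[OF C] M.zero by simp
    then show ?thesis by (simp add: C_def)
  qed
  have "P \<in> A" using effectsD(1)[OF P(1)] by (simp add: sa_iff)
  then have "P \<in> op_center A" using comm central_if_commutes_with_skew by blast
  then obtain c where c: "P = scaleC_op c id_blinfun" using fact by blast
  show ?thesis
  proof (cases "\<exists>x::'h. x \<noteq> 0")
    case False
    then have "P = 0" by (intro blinfun_eqI) simp
    then show ?thesis by (simp add: P_def)
  next
    case True
    then obtain x :: 'h where x: "x \<noteq> 0" by blast
    have "cinner (P x) x \<in> \<real>\<^sub>\<ge>\<^sub>0"
      using P(1) by (simp add: effects_def op_unit_interval_def positive_op_def)
    then have cx: "c * cinner x x \<in> \<real>\<^sub>\<ge>\<^sub>0" by (simp add: c cinner_scaleC_left)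
    have xx: "Im (cinner x x) = 0" by (metis cinner_commute cnj.sel(2) neg_equal_zero)
    have xr: "Re (cinner x x) > 0" using x by (simp add: Re_cinner)
    have "Im c = 0" using cx xx xr by (simp add: complex_nonneg_Reals_iff)
    then obtain l where l: "c = complex_of_real l" by (metis Reals_cases complex_is_Real_iff)
    have Pl: "P = l *\<^sub>R id_blinfun" by (simp add: c l scaleC_op_of_real)
    have "0 \<le> l * inner x x" "0 \<le> (1 - l) * inner x x"
      using effectsD(2,3)[OF P(1)]
      by (auto simp: nonneg_def Pl minus_blinfun.rep_eq scaleR_blinfun.rep_eq inner_diff_left algebra_simps
          simp del: scaleR_left_diff_distrib)
    moreover have "inner x x > 0" using x by simp
    ultimately have l01: "0 \<le> l" "l \<le> 1"
      using mult_neg_pos[of l "inner x x"] mult_neg_pos[of "1 - l" "inner x x"] by linarith+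
    \<comment> \<open>\<open>P\<close> is the convex combination of \<open>I\<close> and \<open>0\<close> with weight \<open>l\<close>, so \<open>\<eta> P = 0\<close> is the
      same combination of \<open>\<eta> I\<close> and \<open>\<eta> 0\<close>; for \<open>0 < l < 1\<close> positivity forces both to vanish.\<close>
    have "\<eta> (l *\<^sub>R id_blinfun + (1 - l) *\<^sub>R 0) = l *\<^sub>R \<eta> id_blinfun + (1 - l) *\<^sub>R \<eta> 0"
      using \<eta>(2) id_effect zero_effect l01 unfolding affine_fun_on_def by (meson atLeastAtMost_iff)
    then have sum0: "l *\<^sub>R \<eta> id_blinfun + (1 - l) *\<^sub>R \<eta> 0 = 0"
      using P(2) Pl by simp
    show ?thesis
    proof (rule ccontr)
      assume "\<not> ?thesis"
      then have "l \<noteq> 0" "l \<noteq> 1" using Pl by (auto simp: P_def)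
      then have l': "0 < l" "0 < 1 - l" using l01 by auto
      have "\<eta> e = 0" if e: "e \<in> {0, id_blinfun}" for e
      proof (rule sa_antisym)
        have e': "e \<in> effects A" using e zero_effect id_effect by auto
        show "\<eta> e \<in> sa" "nonneg (\<eta> e)" using effectsD \<eta>_in e' by blast+
        have i: "inner (\<eta> id_blinfun y) y \<ge> 0" "inner (\<eta> 0 y) y \<ge> 0" for y
          using effectsD(2)[OF \<eta>_in] id_effect zero_effect by (simp_all add: nonneg_def)
        have "inner ((l *\<^sub>R \<eta> id_blinfun + (1 - l) *\<^sub>R \<eta> 0) y) y = 0" for y
          unfolding sum0 by simp
        then have s: "l * inner (\<eta> id_blinfun y) y + (1 - l) * inner (\<eta> 0 y) y = 0" for y
          by (simp only: plus_blinfun.rep_eq scaleR_blinfun.rep_eq inner_add_left inner_scaleR_left)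
        have "inner (\<eta> id_blinfun y) y = 0" "inner (\<eta> 0 y) y = 0" for y
          using s[of y] i[of y] l' by (auto simp: add_nonneg_eq_0_iff)
        then show "nonneg (- \<eta> e)" using e by (auto simp: nonneg_def uminus_blinfun.rep_eq)
      qed
      then have "\<eta> id_blinfun = \<eta> 0" by simp
      then have "(id_blinfun :: 'h \<Rightarrow>\<^sub>L 'h) = 0"
        using bij id_effect zero_effect bij_betw_inv_into_right \<eta>_def by metis
      then show False using x by (metis blinfun_apply_id_blinfun id_apply zero_blinfun.rep_eq)
    qed
  qed
qed

end

section \<open>Polynomials of an operator and Kadison's inequality\<close>

definition poly_op :: "real poly \<Rightarrow> ('a::real_normed_vector \<Rightarrow>\<^sub>L 'a) \<Rightarrow> ('a \<Rightarrow>\<^sub>L 'a)"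
  where "poly_op p X = fold_coeffs (\<lambda>a S. a *\<^sub>R id_blinfun + (X o\<^sub>L S)) p 0"

lemma poly_op_0 [simp]: "poly_op 0 X = 0"
  by (simp add: poly_op_def)

lemma poly_op_pCons [simp]: "poly_op (pCons a p) X = a *\<^sub>R id_blinfun + (X o\<^sub>L poly_op p X)"
  by (cases "p = 0 \<and> a = 0") (auto simp: poly_op_def)

lemma poly_op_1 [simp]: "poly_op 1 X = id_blinfun"
  by (simp add: one_pCons)

lemma poly_op_add: "poly_op (p + q) X = poly_op p X + poly_op q X"
  by (induction p q rule: poly_induct2) (simp_all add: blinfun_compose_simps algebra_simps)

lemma poly_op_smult: "poly_op (smult c p) X = c *\<^sub>R poly_op p X"
  by (induction p) (simp_all add: blinfun_compose_simps algebra_simps)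

lemma poly_op_mult: "poly_op (p * q) X = poly_op p X o\<^sub>L poly_op q X"
  by (induction p) (simp_all add: poly_op_add poly_op_smult blinfun_compose_simps)

lemma poly_op_commute: "poly_op p X o\<^sub>L poly_op q X = poly_op q X o\<^sub>L poly_op p X"
  by (simp add: poly_op_mult[symmetric] mult.commute)

definition Bernstein_poly :: "nat \<Rightarrow> nat \<Rightarrow> real poly"
  where "Bernstein_poly n k = smult (real (n choose k)) ([:0, 1:] ^ k * [:1, - 1:] ^ (n - k))"

lemma poly_Bernstein_poly: "poly (Bernstein_poly n k) x = Bernstein n k x"
  by (simp add: Bernstein_poly_def Bernstein_def)

lemma sum_Bernstein_poly: "(\<Sum>k\<le>n. Bernstein_poly n k) = 1"
  by (rule poly_ext) (simp add: poly_sum poly_Bernstein_poly)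

lemma sum_k_Bernstein_poly: "(\<Sum>k\<le>n. smult (real k) (Bernstein_poly n k)) = smult (real n) [:0, 1:]"
  by (rule poly_ext) (simp add: poly_sum poly_Bernstein_poly)

lemma sum_kk_Bernstein_poly:
  "(\<Sum>k\<le>n. smult (real k * real k) (Bernstein_poly n k)) =
     smult (real n * (real n - 1)) [:0, 0, 1:] + smult (real n) [:0, 1:]"
proof (rule poly_ext)
  fix x :: real
  have "(\<Sum>k\<le>n. real k * real k * Bernstein n k x) =
      (\<Sum>k\<le>n. real k * (real k - 1) * Bernstein n k x) + (\<Sum>k\<le>n. real k * Bernstein n k x)"
    by (simp only: sum.distrib[symmetric]) (simp add: algebra_simps)
  also have "\<dots> = real n * (real n - 1) * x\<^sup>2 + real n * x" by simp
  finally have *: "(\<Sum>k\<le>n. real k * real k * Bernstein n k x) = real n * (real n - 1) * x\<^sup>2 + real n * x" .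
  show "poly (\<Sum>k\<le>n. smult (real k * real k) (Bernstein_poly n k)) x =
      poly (smult (real n * (real n - 1)) [:0, 0, 1:] + smult (real n) [:0, 1:]) x"
    unfolding poly_sum poly_smult poly_Bernstein_poly * by (simp add: power2_eq_square algebra_simps)
qed

context operator_algebra
begin

lemma poly_op_sa: "X \<in> sa \<Longrightarrow> poly_op p X \<in> sa"
proof (induction p)
  case (pCons a p)
  have "poly_op p X o\<^sub>L X = X o\<^sub>L poly_op p X"
    using poly_op_commute[of p X "[:0, 1:]"] by simp
  with pCons show ?case
    by (simp add: sa_iff closed adj_simps)
qed (simp add: sa_closed)

lemma nonneg_poly_op_square:
  assumes X: "X \<in> sa" and e: "nonneg (poly_op e X)"
  shows "nonneg (poly_op (s * s * e) X)"
proof -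
  have S: "poly_op s X \<in> A" "adj (poly_op s X) = poly_op s X"
    using poly_op_sa[OF X, of s] by (simp_all add: sa_iff)
  have "s * s * e = s * (e * s)" by simp
  then have "poly_op (s * s * e) X = adj (poly_op s X) o\<^sub>L (poly_op e X o\<^sub>L poly_op s X)"
    by (simp only: poly_op_mult S(2))
  then show ?thesis using nonneg_conjugate[OF bounded[OF S(1)] e] by simp
qed

text \<open>Splitting off squares reduces \<open>X\<^sup>i (I - X)\<^sup>j\<close> to exponents at most 1, and
  \<open>x (1 - x) = x\<^sup>2 (1 - x) + (1 - x)\<^sup>2 x\<close> settles the mixed case.\<close>

lemma nonneg_Bernstein_poly:
  assumes X: "X \<in> effects A"
  shows "nonneg (poly_op (Bernstein_poly n k) X)"
proof -
  let ?x = "[:0, 1:] :: real poly" and ?y = "[:1, - 1:] :: real poly"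
  have Xs: "X \<in> sa" using effectsD X by blast
  have x: "nonneg (poly_op ?x X)" using effectsD(2)[OF X] by simp
  have "poly_op ?y X = id_blinfun - X" by (simp add: blinfun_compose_simps)
  then have y: "nonneg (poly_op ?y X)" using effectsD(3)[OF X] by simp
  have "?x * ?y = ?x * ?x * ?y + ?y * ?y * ?x" by simp
  then have xy: "nonneg (poly_op (?x * ?y) X)"
    using nonneg_poly_op_square[OF Xs x, of ?y] nonneg_poly_op_square[OF Xs y, of ?x]
    by (metis nonneg_add poly_op_add)
  have split: "p ^ i = p ^ (i div 2) * p ^ (i div 2) * p ^ (i mod 2)" for p :: "real poly" and i
  proof -
    have "i div 2 + i div 2 + i mod 2 = i" by presburger
    then show ?thesis by (metis power_add)
  qed
  have "nonneg (poly_op (?x ^ i * ?y ^ j) X)" for i j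
  proof -
    let ?e = "?x ^ (i mod 2) * ?y ^ (j mod 2)"
    have "i mod 2 = 0 \<or> i mod 2 = 1" "j mod 2 = 0 \<or> j mod 2 = 1" by auto
    then have e: "nonneg (poly_op ?e X)"
      using x y xy by (elim disjE) (simp_all only: power_0 power_one_right mult_1 mult_1_right poly_op_1 nonneg_id)
    have "?x ^ i * ?y ^ j = (?x ^ (i div 2) * ?y ^ (j div 2)) * (?x ^ (i div 2) * ?y ^ (j div 2)) * ?e"
      using split[of ?x i] split[of ?y j] by (simp only: mult_ac)
    then show ?thesis using nonneg_poly_op_square[OF Xs e] by metis
  qed
  then show ?thesis by (simp only: Bernstein_poly_def poly_op_smult nonneg_scaleR of_nat_0_le_iff)
qed

end

locale unital_positive = sa_linear +
  assumes unital: "L id_blinfun = id_blinfun"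
    and positive: "X \<in> sa \<Longrightarrow> nonneg X \<Longrightarrow> nonneg (L X)"
begin

text \<open>If \<open>p\<^sub>0, \<dots>, p\<^sub>n\<close> are positive operators with sum \<open>I\<close>, \<open>\<Sum> k p\<^sub>k = n X\<close> and
  \<open>\<Sum> k\<^sup>2 p\<^sub>k = Y\<close>, then summing \<open>0 \<le> \<langle>L(p\<^sub>k) u\<^sub>k, u\<^sub>k\<rangle>\<close> over \<open>u\<^sub>k = k v - n L(X) v\<close> gives
  \<open>n\<^sup>2 \<parallel>L(X) v\<parallel>\<^sup>2 \<le> \<langle>L(Y) v, v\<rangle>\<close>.  Evaluating the Bernstein polynomials at \<open>X\<close> yields such a
  family with \<open>Y\<close> equal to \<open>n\<^sup>2 X\<^sup>2\<close> up to order \<open>n\<close>.\<close>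

lemma Kadison_inequality:
  assumes X: "X \<in> effects A"
  shows "nonneg (L (X o\<^sub>L X) - (L X o\<^sub>L L X))"
proof -
  have Xs: "X \<in> sa" using effectsD X by blast
  have LX: "L X \<in> sa" by (rule maps[OF Xs])
  define F where "F x y p = inner (L (poly_op p X) x) y" for x y :: 'a and p
  have F_add: "F x y (p + q) = F x y p + F x y q" for x y p q
    by (simp add: F_def poly_op_add add poly_op_sa Xs plus_blinfun.rep_eq inner_add_left)
  have F_smult: "F x y (smult c p) = c * F x y p" for x y c p
    by (simp add: F_def poly_op_smult scale poly_op_sa Xs scaleR_blinfun.rep_eq)
  have F_0: "F x y 0 = 0" for x y using F_smult[of x y 0 0] by simp
  have F_sum: "F x y (\<Sum>k\<in>S. f k) = (\<Sum>k\<in>S. F x y (f k))" for x y S and f :: "nat \<Rightarrow> real poly"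
    by (induction S rule: infinite_finite_induct) (simp_all add: F_0 F_add)
  have F_x: "F x y [:0, 1:] = inner (L X x) y" for x y by (simp add: F_def)
  have F_xx: "F x y [:0, 0, 1:] = inner (L (X o\<^sub>L X) x) y" for x y by (simp add: F_def)
  have F_1: "F x y 1 = inner x y" for x y by (simp add: F_def unital)
  have "inner (L X v) (L X v) \<le> inner (L (X o\<^sub>L X) v) v" for v
  proof -
    define w where "w = L X v"
    define a where "a = inner (L (X o\<^sub>L X) v) v"
    define b where "b = inner (L X v) v"
    have bound: "inner w w \<le> a + (b - a) / real n" if n: "n > 0" for n
    proof -
      let ?B = "Bernstein_poly n"
      have expand: "F (real k *\<^sub>R v - real n *\<^sub>R w) (real k *\<^sub>R v - real n *\<^sub>R w) p =
          F v v (smult (real k * real k) p) - real n * F v w (smult (real k) p)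
          - real n * F w v (smult (real k) p) + real n * real n * F w w p" for k p
        by (simp only: F_smult)
          (simp add: F_def blinfun.diff_right blinfun.scaleR_right inner_diff_left inner_diff_right
            algebra_simps)
      have "0 \<le> (\<Sum>k\<le>n. F (real k *\<^sub>R v - real n *\<^sub>R w) (real k *\<^sub>R v - real n *\<^sub>R w) (?B k))"
        using positive[OF poly_op_sa[OF Xs] nonneg_Bernstein_poly[OF X]]
        by (intro sum_nonneg) (simp add: F_def nonneg_def)
      also have "\<dots> = (\<Sum>k\<le>n. F v v (smult (real k * real k) (?B k)))
          - real n * (\<Sum>k\<le>n. F v w (smult (real k) (?B k)))
          - real n * (\<Sum>k\<le>n. F w v (smult (real k) (?B k)))
          + real n * real n * (\<Sum>k\<le>n. F w w (?B k))"
        by (simp only: expand sum.distrib sum_subtractf sum_distrib_left)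
      also have "\<dots> = real n * (real n - 1) * a + real n * b - real n * real n * inner w w"
      proof -
        have "(\<Sum>k\<le>n. F v v (smult (real k * real k) (?B k))) = real n * (real n - 1) * a + real n * b"
          by (simp only: F_sum[symmetric] sum_kk_Bernstein_poly) (simp only: F_add F_smult F_x F_xx a_def b_def)
        moreover have "(\<Sum>k\<le>n. F x y (smult (real k) (?B k))) = real n * inner (L X x) y" for x y
          by (simp only: F_sum[symmetric] sum_k_Bernstein_poly) (simp only: F_smult F_x)
        moreover have "(\<Sum>k\<le>n. F w w (?B k)) = inner w w"
          by (simp only: F_sum[symmetric] sum_Bernstein_poly F_1)
        moreover have "inner (L X w) v = inner w w"
          by (simp add: w_def sa_symmetric[OF LX])
        ultimately show ?thesis by (simp add: w_def[symmetric])
      qed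
      finally have "real n * (real n * inner w w) \<le> real n * (real n * a + (b - a))"
        by (simp add: algebra_simps)
      then have "real n * inner w w \<le> real n * a + (b - a)"
        using n by simp
      then show ?thesis using n by (simp add: field_simps)
    qed
    have "(\<lambda>n. a + (b - a) / real (Suc n)) \<longlonglongrightarrow> a + 0"
      by (intro tendsto_intros LIMSEQ_Suc[OF lim_const_over_n])
    then have "inner w w \<le> a + 0"
      by (rule LIMSEQ_le_const) (use bound in blast)
    then show ?thesis by (simp add: a_def w_def)
  qed
  then show ?thesis
    using sa_symmetric[OF LX]
    by (simp add: nonneg_def minus_blinfun.rep_eq inner_diff_left)
qed

end

section \<open>Ideals of a factor and primeness\<close>

text \<open>Least squares in a finite power of a Hilbert space, for a linear space \<open>W\<close> of families:
  minimizing sequences converge by the parallelogram law, and the first variation of the distance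
  at the limit vanishes.  Families are used because the size of the power varies, while the ambient
  Hilbert space is a type.\<close>

lemma least_squares_family:
  fixes x :: "'i \<Rightarrow> 'h::{real_inner, complete_space}"
  assumes fin: "finite F" and ne: "W \<noteq> {}"
    and add: "\<And>u v. u \<in> W \<Longrightarrow> v \<in> W \<Longrightarrow> (\<lambda>i. u i + v i) \<in> W"
    and scale: "\<And>r u. u \<in> W \<Longrightarrow> (\<lambda>i. r *\<^sub>R u i) \<in> W"
  obtains z and u :: "nat \<Rightarrow> 'i \<Rightarrow> 'h" where "\<And>n. u n \<in> W"
    and "\<And>i. i \<in> F \<Longrightarrow> (\<lambda>n. u n i) \<longlonglongrightarrow> z i"
    and "\<And>w. w \<in> W \<Longrightarrow> (\<Sum>i\<in>F. inner (x i - z i) (w i)) = 0"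
proof -
  define J where "J u = (\<Sum>i\<in>F. (norm (x i - u i))\<^sup>2)" for u :: "'i \<Rightarrow> 'h"
  define m where "m = Inf (J ` W)"
  have bdd: "bdd_below (J ` W)" by (rule bdd_belowI2[of _ 0]) (simp add: J_def sum_nonneg)
  have m_le: "m \<le> J u" if "u \<in> W" for u
    unfolding m_def using cInf_lower[OF _ bdd] that by blast
  have "\<exists>u\<in>W. J u < m + 1 / Suc n" for n
    using cInf_lessD[of "J ` W" "m + 1 / Suc n"] ne by (auto simp: m_def)
  then obtain U where U: "\<And>n. U n \<in> W" "\<And>n. J (U n) < m + 1 / Suc n" by metis
  have para: "(norm (u i - v i))\<^sup>2 \<le> 2 * ((J u - m) + (J v - m))"
    if u: "u \<in> W" and v: "v \<in> W" and i: "i \<in> F" for u v i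
  proof -
    define w where "w i = (1/2) *\<^sub>R (u i + v i)" for i
    have "w \<in> W" using add[OF u v] scale[of "\<lambda>i. u i + v i" "1/2"] by (simp add: w_def[abs_def])
    have "(norm (u i - v i))\<^sup>2 \<le> (\<Sum>i\<in>F. (norm (u i - v i))\<^sup>2)"
      using member_le_sum[OF i _ fin, of "\<lambda>i. (norm (u i - v i))\<^sup>2"] by simp
    also have "\<dots> = (\<Sum>i\<in>F. 2 * (norm (x i - u i))\<^sup>2 + 2 * (norm (x i - v i))\<^sup>2 - 4 * (norm (x i - w i))\<^sup>2)"
      by (intro sum.cong refl)
        (simp add: w_def dot_square_norm[symmetric] inner_simps inner_commute algebra_simps)
    also have "\<dots> = 2 * J u + 2 * J v - 4 * J w"
      by (simp add: J_def sum.distrib sum_subtractf sum_distrib_left)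
    also have "\<dots> \<le> 2 * ((J u - m) + (J v - m))" using m_le[OF \<open>w \<in> W\<close>] by simp
    finally show ?thesis .
  qed
  have "convergent (\<lambda>n. U n i)" if i: "i \<in> F" for i
  proof -
    have "Cauchy (\<lambda>n. U n i)"
    proof (rule metric_CauchyI)
      fix e :: real assume e: "0 < e"
      then obtain N where N: "1 / Suc N < e\<^sup>2 / 4"
        using nat_approx_posE[of "e\<^sup>2 / 4"] by auto
      have "dist (U k i) (U l i) < e" if kl: "N \<le> k" "N \<le> l" for k l
      proof -
        have small: "J (U k) - m < e\<^sup>2 / 4" if "N \<le> k" for k
        proof -
          have "1 / real (Suc k) \<le> 1 / real (Suc N)" using that by (simp add: frac_le)
          then show ?thesis using N U(2)[of k] by simp
        qed
        have "(norm (U k i - U l i))\<^sup>2 < e\<^sup>2"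
          using para[OF U(1) U(1) i, of k l] small[OF kl(1)] small[OF kl(2)] by simp
        with e show ?thesis by (simp add: dist_norm power2_less_imp_less)
      qed
      then show "\<exists>M. \<forall>k\<ge>M. \<forall>l\<ge>M. dist (U k i) (U l i) < e" by blast
    qed
    then show ?thesis by (simp add: Cauchy_convergent_iff)
  qed
  then obtain z where z: "\<And>i. i \<in> F \<Longrightarrow> (\<lambda>n. U n i) \<longlonglongrightarrow> z i"
    unfolding convergent_def by metis
  have "(\<Sum>i\<in>F. inner (x i - z i) (w i)) = 0" if w: "w \<in> W" for w
  proof -
    define s where "s u = (\<Sum>i\<in>F. inner (x i - u i) (w i))" for u :: "'i \<Rightarrow> 'h"
    define q where "q = (\<Sum>i\<in>F. (norm (w i))\<^sup>2)"
    have quad: "2 * t * s z \<le> t\<^sup>2 * q" for t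
    proof -
      have le: "2 * t * s (U n) - t\<^sup>2 * q \<le> 1 / real (Suc n)" for n
      proof -
        have "(\<lambda>i. U n i + t *\<^sub>R w i) \<in> W" using add[OF U(1) scale[OF w]] .
        then have "m \<le> J (\<lambda>i. U n i + t *\<^sub>R w i)" by (rule m_le)
        also have "\<dots> = (\<Sum>i\<in>F. (norm (x i - U n i))\<^sup>2 - 2 * t * inner (x i - U n i) (w i) + t\<^sup>2 * (norm (w i))\<^sup>2)"
          unfolding J_def
          by (intro sum.cong refl)
            (simp only: power2_norm_eq_inner, simp add: inner_simps inner_commute algebra_simps power2_eq_square)
        also have "\<dots> = J (U n) - 2 * t * s (U n) + t\<^sup>2 * q"
          by (simp add: J_def s_def q_def sum.distrib sum_subtractf sum_distrib_left)
        finally show ?thesis using U(2)[of n] by simp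
      qed
      have "(\<lambda>n. 2 * t * s (U n) - t\<^sup>2 * q) \<longlonglongrightarrow> 2 * t * s z - t\<^sup>2 * q"
        unfolding s_def by (intro tendsto_intros z)
      moreover have "(\<lambda>n. 1 / real (Suc n)) \<longlonglongrightarrow> 0" by (rule LIMSEQ_Suc[OF lim_1_over_n])
      ultimately have "2 * t * s z - t\<^sup>2 * q \<le> 0"
        by (rule LIMSEQ_le) (use le in blast)
      then show ?thesis by simp
    qed
    have "q \<ge> 0" by (simp add: q_def sum_nonneg)
    show ?thesis
    proof (cases "q = 0")
      case True
      then show ?thesis using quad[of 1] quad[of "- 1"] by (simp add: s_def)
    next
      case False
      with \<open>q \<ge> 0\<close> have "q > 0" by simp
      have "2 * (s z / q) * s z \<le> (s z / q)\<^sup>2 * q" by (rule quad)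
      then have "(s z)\<^sup>2 \<le> 0" using \<open>q > 0\<close> by (simp add: power2_eq_square field_simps)
      then show ?thesis by (simp add: s_def)
    qed
  qed
  then show thesis using that U(1) z by blast
qed

text \<open>A basic neighbourhood in the strong topology constrains the values at finitely many vectors
  only.\<close>

lemma (in operator_algebra) strong_closure_finite:
  assumes closedA: "closedin strong_operator_topology A"
    and approx: "\<And>F e. finite F \<Longrightarrow> 0 < e \<Longrightarrow> \<exists>y\<in>A. \<forall>x\<in>F. dist (y x) (blinfun_apply E x) < e"
  shows "E \<in> A"
proof (rule ccontr)
  assume "E \<notin> A"
  have "openin strong_operator_topology (- A)"
    using closedA by (simp add: closedin_def strong_operator_topology_topspace Compl_eq_Diff_UNIV)
  then obtain V where V: "open V" "- A = blinfun_apply -` V"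
    unfolding strong_operator_topology_def openin_pullback_topology by (metis Int_UNIV_right open_openin)
  have "blinfun_apply E \<in> V" using \<open>E \<notin> A\<close> V(2) by auto
  then obtain X where X: "\<And>i. blinfun_apply E i \<in> X i" "\<And>i. open (X i)" "finite {i. X i \<noteq> UNIV}"
    "(\<Pi>\<^sub>E i\<in>UNIV. X i) \<subseteq> V"
  proof -
    have "openin (product_topology (\<lambda>_. euclidean) UNIV) V" using V(1) by (simp add: open_fun_def)
    from product_topology_open_contains_basis[OF this \<open>blinfun_apply E \<in> V\<close>]
    obtain X where "blinfun_apply E \<in> (\<Pi>\<^sub>E i\<in>UNIV. X i)" "\<And>i. open (X i)" "finite {i. X i \<noteq> UNIV}"
      "(\<Pi>\<^sub>E i\<in>UNIV. X i) \<subseteq> V"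
      by auto
    then show thesis by (intro that[of X]) (simp_all add: PiE_iff)
  qed
  define F where "F = {i. X i \<noteq> UNIV}"
  have "\<exists>e>0. ball (E i) e \<subseteq> X i" for i using X(1,2) open_contains_ball by blast
  then obtain r where r: "\<And>i. r i > 0" "\<And>i. ball (E i) (r i) \<subseteq> X i" by metis
  define e where "e = Min (insert 1 (r ` F))"
  have F: "finite F" using X(3) by (simp add: F_def)
  then have e: "e > 0" "\<And>i. i \<in> F \<Longrightarrow> e \<le> r i" using r(1) by (auto simp: e_def)
  obtain y where y: "y \<in> A" "\<And>x. x \<in> F \<Longrightarrow> dist (y x) (E x) < e"
    using approx[OF F e(1)] by blast
  have "y i \<in> X i" for i
  proof (cases "i \<in> F")
    case True
    then have "y i \<in> ball (E i) (r i)" using y(2)[of i] e(2)[of i] by (simp add: dist_commute)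
    then show ?thesis using r(2) by blast
  qed (simp add: F_def)
  then have "blinfun_apply y \<in> V" using X(4) by (auto simp: PiE_iff)
  then show False using V(2) y(1) by blast
qed

text \<open>For a star-closed two-sided ideal \<open>J\<close> with common kernel \<open>N\<close>, the projection onto the
  orthogonal complement of \<open>N\<close> is a strong limit of elements of \<open>J\<close>: if \<open>z\<close> is the best
  approximation of a finite family \<open>x\<close> by families \<open>(y x\<^sub>i)\<^sub>i\<close> with \<open>y \<in> J\<close>, and
  \<open>r = x - z\<close>, then \<open>\<Sum>\<^sub>i \<parallel>w r\<^sub>i\<parallel>\<^sup>2 = \<Sum>\<^sub>i \<langle>r\<^sub>i, w\<^sup>* w (x\<^sub>i - z\<^sub>i)\<rangle> = 0\<close> for all
  \<open>w \<in> J\<close> because \<open>w\<^sup>* w\<close> and \<open>w\<^sup>* w y\<close> lie in \<open>J\<close>; so every \<open>r\<^sub>i\<close> lies in \<open>N\<close>.  The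
  projection is central, hence trivial in a factor.\<close>

lemma (in operator_algebra) factor_ideal_kernel:
  assumes closedA: "closedin strong_operator_topology A"
    and center: "op_center A = range (\<lambda>c. scaleC_op c id_blinfun)"
    and J: "J \<subseteq> A" "w0 \<in> J" "w0 \<noteq> 0"
    and J_add: "\<And>u v. u \<in> J \<Longrightarrow> v \<in> J \<Longrightarrow> u + v \<in> J"
    and J_scale: "\<And>r u. u \<in> J \<Longrightarrow> r *\<^sub>R u \<in> J"
    and J_left: "\<And>a u. a \<in> A \<Longrightarrow> u \<in> J \<Longrightarrow> a o\<^sub>L u \<in> J"
    and J_right: "\<And>a u. a \<in> A \<Longrightarrow> u \<in> J \<Longrightarrow> u o\<^sub>L a \<in> J"
    and J_adj: "\<And>u. u \<in> J \<Longrightarrow> adj u \<in> J"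
    and ker: "\<And>w. w \<in> J \<Longrightarrow> blinfun_apply w x = 0"
  shows "x = 0"
proof -
  define N where "N = {v::'h. \<forall>w\<in>J. blinfun_apply w v = 0}"
  define M where "M = {v::'h. \<forall>n\<in>N. inner v n = 0}"
  have JA: "w \<in> A" "w \<in> bounded_ops" if "w \<in> J" for w using that J(1) bounded by auto
  have N_sub: "u + v \<in> N" "r *\<^sub>R u \<in> N" "c *\<^sub>C u \<in> N" "u - v \<in> N" if "u \<in> N" "v \<in> N" for u v r c
    using that bounded_opsD[OF JA(2)]
    by (simp_all add: N_def blinfun.add_right blinfun.scaleR_right blinfun.diff_right)
  have M_sub: "u + v \<in> M" "r *\<^sub>R u \<in> M" "c *\<^sub>C u \<in> M" "u - v \<in> M" if "u \<in> M" "v \<in> M" for u v r c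
    using that N_sub(3) by (simp_all add: M_def inner_add_left inner_diff_left inner_scaleC_left)
  have NM: "v = 0" if "v \<in> N" "v \<in> M" for v using that by (auto simp: M_def)
  have range_M: "w v \<in> M" if w: "w \<in> J" for w v
    using J_adj[OF w] by (simp add: M_def N_def inner_adj[OF JA(2)[OF w]])
  have N_inv: "a v \<in> N" if a: "a \<in> A" and v: "v \<in> N" for a v
  proof -
    have "w (a v) = 0" if "w \<in> J" for w
      using J_right[OF a that] v blinfun_apply_blinfun_compose unfolding N_def by (metis (mono_tags, lifting) mem_Collect_eq)
    then show ?thesis by (simp add: N_def)
  qed
  have M_inv: "a v \<in> M" if a: "a \<in> A" and v: "v \<in> M" for a v
    using v N_inv[OF adj_closed[OF a]] by (simp add: M_def inner_adj[OF bounded[OF a]])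
  \<comment> \<open>The residuals \<open>x - z x\<close> of the best simultaneous approximation lie in \<open>N\<close>, so \<open>z x\<close> is the
    component of \<open>x\<close> in \<open>M\<close>, whatever the family.\<close>
  have family: "\<exists>z u. (\<forall>n. u n \<in> J) \<and> (\<forall>x\<in>F. (\<lambda>n. u n x) \<longlonglongrightarrow> z x \<and> z x \<in> M \<and> x - z x \<in> N)"
    if F: "finite F" for F :: "'h set"
  proof -
    have ne: "blinfun_apply ` J \<noteq> {}" using J(2) by blast
    obtain z U where U: "\<And>n. U n \<in> blinfun_apply ` J"
      and z: "\<And>i. i \<in> F \<Longrightarrow> (\<lambda>n. U n i) \<longlonglongrightarrow> z i"
      and orth: "\<And>w. w \<in> blinfun_apply ` J \<Longrightarrow> (\<Sum>i\<in>F. inner (i - z i) (w i)) = 0"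
    proof (rule least_squares_family[OF F ne, of "\<lambda>i. i"])
      show "(\<lambda>i. u i + v i) \<in> blinfun_apply ` J"
        if "u \<in> blinfun_apply ` J" "v \<in> blinfun_apply ` J" for u v
        using that J_add by (force simp: plus_blinfun.rep_eq)
      show "(\<lambda>i. r *\<^sub>R u i) \<in> blinfun_apply ` J" if "u \<in> blinfun_apply ` J" for r :: real and u
        using that J_scale by (force simp: scaleR_blinfun.rep_eq)
    qed blast
    have "\<exists>y. y \<in> J \<and> U n = blinfun_apply y" for n using U[of n] by blast
    then obtain u where u: "\<And>n. u n \<in> J" "\<And>n. U n = blinfun_apply (u n)" by metis
    have "w (i - z i) = 0" if w: "w \<in> J" and i: "i \<in> F" for w i
    proof -
      let ?h = "adj w o\<^sub>L w"
      have h: "?h \<in> J" using J_left[OF JA(1)[OF J_adj[OF w]] w] .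
      have 1: "(\<Sum>i\<in>F. inner (i - z i) (?h i)) = 0"
        using orth[of "blinfun_apply ?h"] h by blast
      have "(\<Sum>i\<in>F. inner (i - z i) (?h (u n i))) = 0" for n
        using orth[of "blinfun_apply (?h o\<^sub>L u n)"] J_right[OF JA(1)[OF u(1)] h] by auto
      moreover have "(\<lambda>n. \<Sum>i\<in>F. inner (i - z i) (?h (u n i))) \<longlonglongrightarrow> (\<Sum>i\<in>F. inner (i - z i) (?h (z i)))"
        using z u(2) by (intro tendsto_intros) simp_all
      ultimately have 2: "(\<Sum>i\<in>F. inner (i - z i) (?h (z i))) = 0"
        by (simp add: LIMSEQ_const_iff)
      have "(\<Sum>i\<in>F. (norm (w (i - z i)))\<^sup>2) = (\<Sum>i\<in>F. inner (i - z i) (?h i) - inner (i - z i) (?h (z i)))"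
        by (intro sum.cong refl)
          (simp add: dot_square_norm[symmetric] inner_adj[OF JA(2)[OF w]] inner_diff_right[symmetric] blinfun.diff_right[symmetric])
      also have "\<dots> = 0" using 1 2 by (simp add: sum_subtractf)
      finally show ?thesis using i F by (simp add: sum_nonneg_eq_0_iff)
    qed
    then have "i - z i \<in> N" if "i \<in> F" for i using that by (simp add: N_def)
    moreover have "z i \<in> M" if i: "i \<in> F" for i
    proof -
      have "inner (z i) n = 0" if n: "n \<in> N" for n
      proof -
        have "(\<lambda>k. inner (U k i) n) \<longlonglongrightarrow> inner (z i) n" by (intro tendsto_intros z i)
        moreover have "inner (U k i) n = 0" for k
          using range_M[OF u(1)] n by (simp add: u(2) M_def)
        ultimately show ?thesis by (simp add: LIMSEQ_const_iff)
      qed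
      then show ?thesis by (simp add: M_def)
    qed
    ultimately show ?thesis using z u by (intro exI[of _ z] exI[of _ u]) simp
  qed
  have "\<exists>z. z \<in> M \<and> v - z \<in> N" for v using family[of "{v}"] by auto
  then obtain e where e: "\<And>v. e v \<in> M" "\<And>v. v - e v \<in> N" by metis
  have e_unique: "z = e v" if "z \<in> M" "v - z \<in> N" for v z
  proof -
    have "z - e v \<in> M" using M_sub(4) that e(1) by blast
    moreover have "z - e v \<in> N" using N_sub(4)[OF e(2)[of v] that(2)] by simp
    ultimately show ?thesis using NM by fastforce
  qed
  have "bounded_linear e"
  proof (rule bounded_linear_intro[where K = 1])
    fix u v :: 'h and r :: real
    show "e (u + v) = e u + e v"
      by (rule e_unique[symmetric]) (use M_sub(1) e N_sub(1)[OF e(2) e(2), of u v] in \<open>simp_all add: algebra_simps\<close>)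
    show "e (r *\<^sub>R u) = r *\<^sub>R e u"
      by (rule e_unique[symmetric]) (use M_sub(2)[OF e(1) e(1)] N_sub(2)[OF e(2) e(2), of r u] in \<open>simp_all add: algebra_simps\<close>)
    have "inner (e u) (u - e u) = 0" using e by (simp add: M_def)
    then have "norm (e u) * norm (e u) = inner (e u) u"
      by (simp add: inner_diff_right dot_square_norm power2_eq_square)
    also have "\<dots> \<le> norm (e u) * norm u" by (rule norm_cauchy_schwarz)
    finally show "norm (e u) \<le> norm u * 1" by (cases "e u = 0") auto
  qed
  from bounded_linear_Blinfun_apply[OF this] obtain E where E: "\<And>v. blinfun_apply E v = e v"
    by metis
  have EA: "E \<in> A"
  proof (rule strong_closure_finite[OF closedA])
    fix F :: "'h set" and d :: real assume F: "finite F" and d: "0 < d"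
    obtain z u where u: "\<And>n. u n \<in> J"
      and z: "\<And>x. x \<in> F \<Longrightarrow> (\<lambda>n. u n x) \<longlonglongrightarrow> z x" "\<And>x. x \<in> F \<Longrightarrow> z x \<in> M \<and> x - z x \<in> N"
      using family[OF F] by blast
    have "\<forall>x\<in>F. eventually (\<lambda>n. dist (u n x) (E x) < d) sequentially"
    proof
      fix x assume x: "x \<in> F"
      then have "z x = E x" using z(2) e_unique E by metis
      then show "eventually (\<lambda>n. dist (u n x) (E x) < d) sequentially"
        using tendstoD[OF z(1)[OF x] d] by simp
    qed
    then have "eventually (\<lambda>n. \<forall>x\<in>F. dist (u n x) (E x) < d) sequentially"
      using F by (simp add: eventually_ball_finite)
    then obtain n where "\<forall>x\<in>F. dist (u n x) (E x) < d"
      using eventually_happens' sequentially_bot by blast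
    then show "\<exists>y\<in>A. \<forall>x\<in>F. dist (y x) (E x) < d" using u J(1) by blast
  qed
  have "E o\<^sub>L a = a o\<^sub>L E" if a: "a \<in> A" for a
  proof (rule blinfun_eqI)
    fix v
    have "a (e v) = e (a v)"
      by (rule e_unique) (use M_inv[OF a e(1)] N_inv[OF a e(2), of v] in \<open>simp_all add: blinfun.diff_right\<close>)
    then show "(E o\<^sub>L a) v = (a o\<^sub>L E) v" by (simp add: E)
  qed
  then have "E \<in> op_center A" using EA by (simp add: op_center_def)
  then obtain c where "E = scaleC_op c id_blinfun" using center by blast
  then have c: "e v = c *\<^sub>C v" for v using E by (metis scaleC_op_apply blinfun_apply_id_blinfun id_apply)
  obtain v where v: "w0 v \<noteq> 0" using J(3) by (metis blinfun_eqI zero_blinfun.rep_eq)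
  have "0 \<in> N" by (simp add: N_def)
  then have "e (w0 v) = w0 v" using e_unique[of "w0 v" "w0 v"] range_M[OF J(2)] by simp
  then have "(c - 1) *\<^sub>C w0 v = 0"
    using c[of "w0 v"] scaleC_add_left[of c "- 1" "w0 v"] by (simp add: scaleC_minus_one)
  then have "cmod (c - 1) * norm (w0 v) = 0" using norm_scaleC by (metis norm_zero)
  then have "c = 1" using v by simp
  moreover have "x \<in> N" using ker by (simp add: N_def)
  ultimately have "x \<in> M" using e(1)[of x] c[of x] scaleC_of_real[of 1 x] by simp
  then show ?thesis using NM \<open>x \<in> N\<close> by blast
qed

text \<open>The elements \<open>y\<close> with \<open>a A y = 0\<close> and \<open>a A y\<^sup>* = 0\<close> form a star-closed ideal that contains
  \<open>b b\<^sup>*\<close>.  If \<open>b \<noteq> 0\<close>, its common kernel is therefore zero; but the kernel contains the range of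
  \<open>a\<^sup>*\<close>.\<close>

lemma (in operator_algebra) factor_prime:
  assumes closedA: "closedin strong_operator_topology A"
    and center: "op_center A = range (\<lambda>c. scaleC_op c id_blinfun)"
    and a: "a \<in> A" and b: "b \<in> A" and ab: "\<And>x. x \<in> A \<Longrightarrow> a o\<^sub>L (x o\<^sub>L b) = 0"
  shows "a = 0 \<or> b = 0"
proof (rule disjCI)
  assume "b \<noteq> 0"
  define J where "J = {y \<in> A. \<forall>x\<in>A. a o\<^sub>L (x o\<^sub>L y) = 0 \<and> a o\<^sub>L (x o\<^sub>L adj y) = 0}"
  have bb: "b o\<^sub>L adj b \<in> J"
  proof -
    have "a o\<^sub>L (x o\<^sub>L (b o\<^sub>L adj b)) = 0" if "x \<in> A" for x
    proof -
      have "a o\<^sub>L (x o\<^sub>L (b o\<^sub>L adj b)) = (a o\<^sub>L (x o\<^sub>L b)) o\<^sub>L adj b"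
        by (simp add: blinfun_compose_assoc)
      then show ?thesis using ab[OF that] by simp
    qed
    then show ?thesis using b by (simp add: J_def closed adj_simps)
  qed
  have "b o\<^sub>L adj b \<noteq> 0"
  proof
    assume 0: "b o\<^sub>L adj b = 0"
    have "inner (adj b v) (adj b v) = 0" for v
      using 0 inner_adj[OF bounded[OF b], of "adj b v" v] by (metis blinfun_apply_blinfun_compose inner_zero_left zero_blinfun.rep_eq)
    then have "adj b = 0" by (intro blinfun_eqI) simp
    then have "adj (adj b) = 0" using adj_zero by simp
    then show False using \<open>b \<noteq> 0\<close> b by (simp add: bounded)
  qed
  have J_mul: "u o\<^sub>L s \<in> J \<and> s o\<^sub>L u \<in> J" if s: "s \<in> A" and u: "u \<in> J" for s u
  proof -
    have "a o\<^sub>L (x o\<^sub>L (s o\<^sub>L y)) = 0 \<and> a o\<^sub>L (x o\<^sub>L (y o\<^sub>L s)) = 0"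
      if "x \<in> A" "s \<in> A" "y = u \<or> y = adj u" for x s y
    proof -
      have "a o\<^sub>L (x' o\<^sub>L y) = 0" if "x' \<in> A" for x' using u that \<open>y = u \<or> y = adj u\<close> by (auto simp: J_def)
      from this[of "x o\<^sub>L s"] this[of x] show ?thesis
        using that(1,2) by (simp add: closed blinfun_compose_assoc[symmetric])
    qed
    then show ?thesis using u s by (simp add: J_def closed adj_compose bounded)
  qed
  have "adj a v = 0" for v
  proof (rule factor_ideal_kernel[OF closedA center, of J "b o\<^sub>L adj b"])
    fix u w s and r :: real
    show "J \<subseteq> A" by (auto simp: J_def)
    show "b o\<^sub>L adj b \<in> J" "b o\<^sub>L adj b \<noteq> 0" by fact+
    show "s o\<^sub>L u \<in> J" "u o\<^sub>L s \<in> J" if "s \<in> A" "u \<in> J" using J_mul that by blast+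
    show "u + w \<in> J" if "u \<in> J" "w \<in> J"
      using that by (simp add: J_def closed adj_simps blinfun_compose_simps)
    show "r *\<^sub>R u \<in> J" if "u \<in> J"
      using that by (simp add: J_def closed adj_simps blinfun_compose_simps)
    show "adj u \<in> J" if "u \<in> J"
      using that by (simp add: J_def closed adj_simps)
    show "u (adj a v) = 0" if "u \<in> J"
    proof -
      have "u \<in> A" "a o\<^sub>L adj u = 0" using that id_closed by (auto simp: J_def dest!: bspec[of _ _ id_blinfun])
      then have "u o\<^sub>L adj a = 0" using adj_compose[of a "adj u"] a by (simp add: bounded closed adj_zero)
      then show ?thesis by (metis blinfun_apply_blinfun_compose zero_blinfun.rep_eq)
    qed
  qed
  then have "adj a = 0" by (intro blinfun_eqI) simp
  then have "adj (adj a) = 0" using adj_zero by simp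
  then show "a = 0" using a by (simp add: bounded)
qed

section \<open>Jordan maps onto prime algebras\<close>

context operator_algebra
begin

text \<open>The instances of the hypothesis for \<open>x g y\<close>, \<open>x\<close> and \<open>y\<close> combine to \<open>2 g x g y f = 0\<close>.  If
  \<open>f \<noteq> 0\<close>, primeness yields \<open>g x g = 0\<close> for all \<open>x\<close>, and then \<open>g = 0\<close>.\<close>

lemma prime_skew_product:
  assumes prime: "\<And>a b. a \<in> A \<Longrightarrow> b \<in> A \<Longrightarrow> (\<And>x. x \<in> A \<Longrightarrow> a o\<^sub>L (x o\<^sub>L b) = 0) \<Longrightarrow> a = 0 \<or> b = 0"
    and f: "f \<in> A" and g: "g \<in> A"
    and skew: "\<And>x. x \<in> A \<Longrightarrow> (f o\<^sub>L (x o\<^sub>L g)) + (g o\<^sub>L (x o\<^sub>L f)) = 0"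
  shows "f = 0 \<or> g = 0"
proof -
  have "(g o\<^sub>L (x o\<^sub>L g)) o\<^sub>L (y o\<^sub>L f) = 0" if x: "x \<in> A" and y: "y \<in> A" for x y
  proof -
    have 1: "(f o\<^sub>L ((x o\<^sub>L (g o\<^sub>L y)) o\<^sub>L g)) + (g o\<^sub>L ((x o\<^sub>L (g o\<^sub>L y)) o\<^sub>L f)) = 0"
      using x y g by (intro skew) (simp add: closed)
    have 2: "((f o\<^sub>L (x o\<^sub>L g)) + (g o\<^sub>L (x o\<^sub>L f))) o\<^sub>L (y o\<^sub>L g) = 0"
      using skew[OF x] by simp
    have 3: "(g o\<^sub>L x) o\<^sub>L ((f o\<^sub>L (y o\<^sub>L g)) + (g o\<^sub>L (y o\<^sub>L f))) = 0"
      using skew[OF y] by simp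
    define t where "t = g o\<^sub>L (x o\<^sub>L (g o\<^sub>L (y o\<^sub>L f)))"
    have "t + t = 0"
      using 1 2 3 unfolding t_def blinfun_compose_simps by (metis add.commute add_eq_0_iff minus_minus)
    then have "2 *\<^sub>R t = 0" by (simp add: scaleR_2)
    then show ?thesis by (simp add: t_def blinfun_compose_assoc)
  qed
  then have "g o\<^sub>L (x o\<^sub>L g) = 0 \<or> f = 0" if "x \<in> A" for x
    using prime[of "g o\<^sub>L (x o\<^sub>L g)" f] f g that by (simp add: closed)
  then show ?thesis using prime[of g g] g by blast
qed

text \<open>For fixed \<open>a\<close>, \<open>b\<close> put \<open>f = \<phi>(a b) - \<phi>(a) \<phi>(b)\<close> and \<open>g = \<phi>(a b) - \<phi>(b) \<phi>(a)\<close>.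
  Evaluating \<open>\<phi>(a b x b a + b a x a b)\<close> in two ways shows \<open>f y g + g y f = 0\<close> for
  \<open>y = \<phi>(x)\<close>, so each pair \<open>(a, b)\<close> is treated multiplicatively or antimultiplicatively.  As a
  group is not the union of two proper subgroups, one alternative holds for all pairs.\<close>

lemma Jordan_onto_prime:
  assumes prime: "\<And>a b. a \<in> A \<Longrightarrow> b \<in> A \<Longrightarrow> (\<And>x. x \<in> A \<Longrightarrow> a o\<^sub>L (x o\<^sub>L b) = 0) \<Longrightarrow> a = 0 \<or> b = 0"
    and surj: "\<phi> ` A = A"
    and add: "\<And>a b. a \<in> A \<Longrightarrow> b \<in> A \<Longrightarrow> \<phi> (a + b) = \<phi> a + \<phi> b"
    and square: "\<And>a. a \<in> A \<Longrightarrow> \<phi> (a o\<^sub>L a) = \<phi> a o\<^sub>L \<phi> a"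
  shows "(\<forall>a\<in>A. \<forall>b\<in>A. \<phi> (a o\<^sub>L b) = \<phi> a o\<^sub>L \<phi> b) \<or> (\<forall>a\<in>A. \<forall>b\<in>A. \<phi> (a o\<^sub>L b) = \<phi> b o\<^sub>L \<phi> a)"
proof -
  have into: "\<phi> a \<in> A" if "a \<in> A" for a using surj that by blast
  have cancel_double: "X = Y" if "X + X = Y + Y" for X Y :: "'h \<Rightarrow>\<^sub>L 'h"
  proof -
    have "2 *\<^sub>R X = 2 *\<^sub>R Y" using that by (simp only: scaleR_2)
    then show ?thesis by simp
  qed
  have anti: "\<phi> (a o\<^sub>L b) + \<phi> (b o\<^sub>L a) = (\<phi> a o\<^sub>L \<phi> b) + (\<phi> b o\<^sub>L \<phi> a)" if "a \<in> A" "b \<in> A" for a b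
  proof -
    have "\<phi> ((a + b) o\<^sub>L (a + b)) = \<phi> (a o\<^sub>L a) + \<phi> (a o\<^sub>L b) + (\<phi> (b o\<^sub>L a) + \<phi> (b o\<^sub>L b))"
      using that by (simp add: blinfun_compose_add add closed add_ac)
    moreover have "\<phi> ((a + b) o\<^sub>L (a + b)) = (\<phi> a + \<phi> b) o\<^sub>L (\<phi> a + \<phi> b)"
      using that by (simp add: square add closed)
    ultimately show ?thesis
      using that by (simp add: square blinfun_compose_add add_ac)
  qed
  \<comment> \<open>With \<open>{a, b} = a b + b a\<close> one has \<open>2 a b a = {a, {a, b}} - {a\<^sup>2, b}\<close>.\<close>
  have triple: "\<phi> (a o\<^sub>L (b o\<^sub>L a)) = \<phi> a o\<^sub>L (\<phi> b o\<^sub>L \<phi> a)" if a: "a \<in> A" and b: "b \<in> A" for a b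
  proof (rule cancel_double)
    let ?c = "(a o\<^sub>L b) + (b o\<^sub>L a)"
    have c: "\<phi> ?c = (\<phi> a o\<^sub>L \<phi> b) + (\<phi> b o\<^sub>L \<phi> a)" using a b by (simp add: add closed anti)
    have 1: "\<phi> (a o\<^sub>L ?c) + \<phi> (?c o\<^sub>L a) = (\<phi> a o\<^sub>L \<phi> ?c) + (\<phi> ?c o\<^sub>L \<phi> a)"
      using a b by (intro anti) (simp_all add: closed)
    have 2: "\<phi> (a o\<^sub>L (a o\<^sub>L b)) + \<phi> (b o\<^sub>L (a o\<^sub>L a)) =
        (\<phi> a o\<^sub>L (\<phi> a o\<^sub>L \<phi> b)) + (\<phi> b o\<^sub>L (\<phi> a o\<^sub>L \<phi> a))"
      using anti[of "a o\<^sub>L a" b] a b by (simp add: closed square blinfun_compose_assoc)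
    have "\<phi> (a o\<^sub>L ?c) + \<phi> (?c o\<^sub>L a) =
        (\<phi> (a o\<^sub>L (b o\<^sub>L a)) + \<phi> (a o\<^sub>L (b o\<^sub>L a))) + (\<phi> (a o\<^sub>L (a o\<^sub>L b)) + \<phi> (b o\<^sub>L (a o\<^sub>L a)))"
      using a b by (simp add: blinfun_compose_add blinfun_compose_assoc add closed add_ac)
    moreover have "(\<phi> a o\<^sub>L \<phi> ?c) + (\<phi> ?c o\<^sub>L \<phi> a) =
        ((\<phi> a o\<^sub>L (\<phi> b o\<^sub>L \<phi> a)) + (\<phi> a o\<^sub>L (\<phi> b o\<^sub>L \<phi> a))) +
        ((\<phi> a o\<^sub>L (\<phi> a o\<^sub>L \<phi> b)) + (\<phi> b o\<^sub>L (\<phi> a o\<^sub>L \<phi> a)))"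
      by (simp add: c blinfun_compose_add blinfun_compose_assoc add_ac)
    ultimately show "\<phi> (a o\<^sub>L (b o\<^sub>L a)) + \<phi> (a o\<^sub>L (b o\<^sub>L a)) =
        (\<phi> a o\<^sub>L (\<phi> b o\<^sub>L \<phi> a)) + (\<phi> a o\<^sub>L (\<phi> b o\<^sub>L \<phi> a))"
      using 1 2 by (metis add_right_cancel)
  qed
  have triple2: "\<phi> (a o\<^sub>L (b o\<^sub>L c)) + \<phi> (c o\<^sub>L (b o\<^sub>L a)) =
      (\<phi> a o\<^sub>L (\<phi> b o\<^sub>L \<phi> c)) + (\<phi> c o\<^sub>L (\<phi> b o\<^sub>L \<phi> a))" if "a \<in> A" "b \<in> A" "c \<in> A" for a b c
  proof -
    have "\<phi> ((a + c) o\<^sub>L (b o\<^sub>L (a + c))) = (\<phi> a + \<phi> c) o\<^sub>L (\<phi> b o\<^sub>L (\<phi> a + \<phi> c))"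
      using that by (simp add: triple add closed)
    moreover have "\<phi> ((a + c) o\<^sub>L (b o\<^sub>L (a + c))) = \<phi> (a o\<^sub>L (b o\<^sub>L a)) + \<phi> (a o\<^sub>L (b o\<^sub>L c)) +
        (\<phi> (c o\<^sub>L (b o\<^sub>L a)) + \<phi> (c o\<^sub>L (b o\<^sub>L c)))"
      using that by (simp add: blinfun_compose_add add closed add_ac)
    ultimately show ?thesis
      using that by (simp add: triple blinfun_compose_add add_ac)
  qed
  define F where "F a b \<longleftrightarrow> \<phi> (a o\<^sub>L b) = \<phi> a o\<^sub>L \<phi> b" for a b
  define G where "G a b \<longleftrightarrow> \<phi> (a o\<^sub>L b) = \<phi> b o\<^sub>L \<phi> a" for a b
  have dichotomy: "F a b \<or> G a b" if a: "a \<in> A" and b: "b \<in> A" for a b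
  proof -
    define u v p q where "u = \<phi> (a o\<^sub>L b)" and "v = \<phi> (b o\<^sub>L a)"
      and "p = \<phi> a o\<^sub>L \<phi> b" and "q = \<phi> b o\<^sub>L \<phi> a"
    have in_A: "u \<in> A" "p \<in> A" "q \<in> A" using a b by (simp_all add: u_def p_def q_def closed into)
    have "u + v = p + q" unfolding u_def v_def p_def q_def by (rule anti[OF a b])
    then have v: "v = p + q - u" by (simp add: algebra_simps)
    have skew: "((u - p) o\<^sub>L (y o\<^sub>L (u - q))) + ((u - q) o\<^sub>L (y o\<^sub>L (u - p))) = 0" if y: "y \<in> A" for y
    proof -
      obtain x where x: "x \<in> A" "y = \<phi> x" using surj y by blast
      have "(u o\<^sub>L (y o\<^sub>L v)) + (v o\<^sub>L (y o\<^sub>L u)) =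
          \<phi> ((a o\<^sub>L b) o\<^sub>L (x o\<^sub>L (b o\<^sub>L a))) + \<phi> ((b o\<^sub>L a) o\<^sub>L (x o\<^sub>L (a o\<^sub>L b)))"
        using triple2[of "a o\<^sub>L b" x "b o\<^sub>L a"] a b x by (simp add: closed u_def v_def)
      also have "\<dots> = \<phi> (a o\<^sub>L ((b o\<^sub>L (x o\<^sub>L b)) o\<^sub>L a)) + \<phi> (b o\<^sub>L ((a o\<^sub>L (x o\<^sub>L a)) o\<^sub>L b))"
        by (simp add: blinfun_compose_assoc)
      also have "\<dots> = (p o\<^sub>L (y o\<^sub>L q)) + (q o\<^sub>L (y o\<^sub>L p))"
        by (simp only: triple closed a b x) (simp add: p_def q_def blinfun_compose_assoc)
      finally show ?thesis
        unfolding v by (simp add: blinfun_compose_simps algebra_simps)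
    qed
    have "u - p = 0 \<or> u - q = 0"
      by (rule prime_skew_product[OF prime _ _ skew]) (use in_A in \<open>simp_all add: closed\<close>)
    then show ?thesis by (simp add: F_def G_def u_def p_def q_def)
  qed
  \<comment> \<open>Each of the relations \<open>F\<close> and \<open>G\<close> cuts out an additive subgroup when one argument is
    fixed.\<close>
  have shift: "F a (b + c) \<longleftrightarrow> F a c" if "F a b" "a \<in> A" "b \<in> A" "c \<in> A" for a b c
    using that by (simp add: F_def blinfun_compose_add add closed)
  have shift': "F (b + c) a \<longleftrightarrow> F c a" if "F b a" "a \<in> A" "b \<in> A" "c \<in> A" for a b c
    using that by (simp add: F_def blinfun_compose_add add closed)
  have shiftG: "G a (c + b) \<longleftrightarrow> G a c" if "G a b" "a \<in> A" "b \<in> A" "c \<in> A" for a b c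
    using that by (simp add: G_def blinfun_compose_add add closed)
  have shiftG': "G (c + b) a \<longleftrightarrow> G c a" if "G b a" "a \<in> A" "b \<in> A" "c \<in> A" for a b c
    using that by (simp add: G_def blinfun_compose_add add closed)
  have row: "(\<forall>b\<in>A. F a b) \<or> (\<forall>b\<in>A. G a b)" if a: "a \<in> A" for a
  proof (rule ccontr)
    assume "\<not> ?thesis"
    then obtain b c where bc: "b \<in> A" "\<not> F a b" "c \<in> A" "\<not> G a c" by blast
    then have "G a b" "F a c" using dichotomy[OF a] by blast+
    then show False
      using dichotomy[OF a, of "c + b"] shift[of a c b] shiftG[of a b c] bc a by (simp add: closed)
  qed
  show ?thesis
  proof (rule ccontr)
    assume "\<not> ?thesis"
    then obtain a c where ac: "a \<in> A" "\<not> (\<forall>b\<in>A. F a b)" "c \<in> A" "\<not> (\<forall>b\<in>A. G c b)"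
      unfolding F_def G_def by blast
    then have G: "\<forall>b\<in>A. G a b" and F: "\<forall>b\<in>A. F c b" using row by blast+
    have "\<not> (\<forall>b\<in>A. F (c + a) b)" using ac F shift'[of c _ a] by blast
    moreover have "\<not> (\<forall>b\<in>A. G (c + a) b)" using ac G shiftG'[of a _ c] by blast
    ultimately show False using row[OF add_closed[OF ac(3,1)]] by blast
  qed
qed

end

section \<open>Effect automorphisms fixing zero\<close>

definition Re_op :: "('h::chilbert_space \<Rightarrow>\<^sub>L 'h) \<Rightarrow> ('h \<Rightarrow>\<^sub>L 'h)"
  where "Re_op S = (1/2) *\<^sub>R (S + adj S)"

definition Im_op :: "('h::chilbert_space \<Rightarrow>\<^sub>L 'h) \<Rightarrow> ('h \<Rightarrow>\<^sub>L 'h)"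
  where "Im_op S = scaleC_op (- \<i> / 2) (S - adj S)"

definition complexify :: "(('h::chilbert_space \<Rightarrow>\<^sub>L 'h) \<Rightarrow> ('h \<Rightarrow>\<^sub>L 'h)) \<Rightarrow> ('h \<Rightarrow>\<^sub>L 'h) \<Rightarrow> ('h \<Rightarrow>\<^sub>L 'h)"
  where "complexify L S = L (Re_op S) + scaleC_op \<i> (L (Im_op S))"

lemma scaleC_op_zero: "scaleC_op c 0 = 0"
  by (rule blinfun_eqI) simp

lemma scaleC_op_compose_left: "scaleC_op c S o\<^sub>L T = scaleC_op c (S o\<^sub>L T)"
  by (rule blinfun_eqI) simp

lemma scaleC_op_compose_right: "S \<in> bounded_ops \<Longrightarrow> S o\<^sub>L scaleC_op c T = scaleC_op c (S o\<^sub>L T)"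
  by (rule blinfun_eqI) (simp add: bounded_opsD)

lemma scaleC_op_i_i: "scaleC_op \<i> (scaleC_op \<i> T) = - T"
  using scaleC_op_of_real[of "- 1" T] by (simp add: scaleC_op_scaleC_op)

lemma scaleC_op_Complex:
  "scaleC_op c (X + scaleC_op \<i> Y) =
     (Re c *\<^sub>R X - Im c *\<^sub>R Y) + scaleC_op \<i> (Im c *\<^sub>R X + Re c *\<^sub>R Y)"
proof (rule blinfun_eqI)
  fix x
  have c: "c *\<^sub>C v = Re c *\<^sub>R v + Im c *\<^sub>R (\<i> *\<^sub>C v)" for v :: 'a
  proof -
    have "c *\<^sub>C v = (complex_of_real (Re c) + complex_of_real (Im c) * \<i>) *\<^sub>C v"
      by (metis complex_eq mult.commute)
    then show ?thesis by (simp add: scaleC_add_left scaleC_scaleC[symmetric] scaleC_of_real)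
  qed
  have ii: "\<i> *\<^sub>C (\<i> *\<^sub>C v) = - v" for v :: 'a by (simp add: scaleC_scaleC scaleC_minus_one)
  show "scaleC_op c (X + scaleC_op \<i> Y) x =
     ((Re c *\<^sub>R X - Im c *\<^sub>R Y) + scaleC_op \<i> (Im c *\<^sub>R X + Re c *\<^sub>R Y)) x"
    unfolding scaleC_op_apply plus_blinfun.rep_eq minus_blinfun.rep_eq scaleR_blinfun.rep_eq
      c[of "X x + \<i> *\<^sub>C Y x"]
    by (simp add: scaleC_add_right scaleC_scaleR ii scaleR_add_right scaleR_diff_right)
qed

context operator_algebra
begin

lemma cartesian_parts:
  assumes X: "X \<in> sa" and Y: "Y \<in> sa"
  shows "Re_op (X + scaleC_op \<i> Y) = X" "Im_op (X + scaleC_op \<i> Y) = Y"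
proof -
  have adj: "adj (X + scaleC_op \<i> Y) = X - scaleC_op \<i> Y"
    using X Y by (intro blinfun_eqI)
      (simp add: sa_iff adj_simps closed plus_blinfun.rep_eq minus_blinfun.rep_eq scaleC_minus_left)
  show "Re_op (X + scaleC_op \<i> Y) = X"
    unfolding Re_op_def adj by (simp add: scaleR_2[symmetric])
  show "Im_op (X + scaleC_op \<i> Y) = Y"
  proof -
    have "(X + scaleC_op \<i> Y) - (X - scaleC_op \<i> Y) = 2 *\<^sub>R scaleC_op \<i> Y" by (simp add: scaleR_2)
    then have "Im_op (X + scaleC_op \<i> Y) = scaleC_op (- \<i> / 2 * (complex_of_real 2 * \<i>)) Y"
      unfolding Im_op_def adj by (simp only: scaleC_op_of_real[symmetric] scaleC_op_scaleC_op)
    also have "- \<i> / 2 * (complex_of_real 2 * \<i>) = complex_of_real 1" by simp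
    finally show ?thesis by (simp only: scaleC_op_of_real) simp
  qed
qed

lemma cartesian_decomposition:
  assumes "S \<in> A"
  obtains X Y where "X \<in> sa" "Y \<in> sa" "S = X + scaleC_op \<i> Y"
proof
  show "Re_op S \<in> sa"
    using assms by (simp add: sa_iff Re_op_def closed adj_simps add.commute)
  have "adj (Im_op S) = scaleC_op (\<i> / 2) (- (S - adj S))"
    using assms by (simp add: Im_op_def closed adj_simps)
  also have "\<dots> = Im_op S"
    by (rule blinfun_eqI) (simp add: Im_op_def minus_blinfun.rep_eq scaleC_diff_right scaleC_minus_left)
  finally show "Im_op S \<in> sa"
    using assms by (simp add: sa_iff Im_op_def closed)
  have "scaleC_op \<i> (Im_op S) = (1/2) *\<^sub>R (S - adj S)"
    by (simp add: Im_op_def scaleC_op_scaleC_op scaleC_op_of_real[symmetric])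
  then show "S = Re_op S + scaleC_op \<i> (Im_op S)"
    by (simp add: Re_op_def scaleR_add_right[symmetric] scaleR_2[symmetric])
qed

end

context sa_linear
begin

lemma complexify_cartesian:
  "X \<in> sa \<Longrightarrow> Y \<in> sa \<Longrightarrow> complexify L (X + scaleC_op \<i> Y) = L X + scaleC_op \<i> (L Y)"
  by (simp add: complexify_def cartesian_parts)

lemma complexify_sa: "X \<in> sa \<Longrightarrow> complexify L X = L X"
  using complexify_cartesian[of X 0] sa_closed(2)
  by (simp add: zero scaleC_op_zero)

lemma complexify_closed: "S \<in> A \<Longrightarrow> complexify L S \<in> A"
  by (rule cartesian_decomposition[of S]) (auto simp: complexify_cartesian closed saD maps)

lemma complexify_add:
  assumes "S \<in> A" "T \<in> A" shows "complexify L (S + T) = complexify L S + complexify L T"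
proof -
  obtain X Y where S: "X \<in> sa" "Y \<in> sa" "S = X + scaleC_op \<i> Y" by (rule cartesian_decomposition[OF assms(1)])
  obtain X' Y' where T: "X' \<in> sa" "Y' \<in> sa" "T = X' + scaleC_op \<i> Y'" by (rule cartesian_decomposition[OF assms(2)])
  have "S + T = (X + X') + scaleC_op \<i> (Y + Y')" by (simp add: S T scaleC_op_add add_ac)
  then have "complexify L (S + T) = (L X + L X') + scaleC_op \<i> (L Y + L Y')"
    using S(1,2) T(1,2) by (simp only: complexify_cartesian sa_closed add)
  then show ?thesis
    unfolding S(3) T(3) using S(1,2) T(1,2)
    by (simp only: complexify_cartesian scaleC_op_add add_ac)
qed

lemma complexify_scaleC:
  assumes "S \<in> A" shows "complexify L (scaleC_op c S) = scaleC_op c (complexify L S)"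
proof -
  obtain X Y where S: "X \<in> sa" "Y \<in> sa" "S = X + scaleC_op \<i> Y" by (rule cartesian_decomposition[OF assms(1)])
  then have "complexify L (scaleC_op c S) =
      (Re c *\<^sub>R L X - Im c *\<^sub>R L Y) + scaleC_op \<i> (Im c *\<^sub>R L X + Re c *\<^sub>R L Y)"
    unfolding S(3) scaleC_op_Complex by (simp add: complexify_cartesian sa_closed add diff scale)
  then show ?thesis
    unfolding S(3) using S by (simp only: complexify_cartesian scaleC_op_Complex)
qed

lemma complexify_adj:
  assumes "S \<in> A" shows "complexify L (adj S) = adj (complexify L S)"
proof -
  obtain X Y where S: "X \<in> sa" "Y \<in> sa" "S = X + scaleC_op \<i> Y" by (rule cartesian_decomposition[OF assms(1)])
  have adj: "adj (X' + scaleC_op \<i> Y') = X' + scaleC_op \<i> (- Y')" if "X' \<in> sa" "Y' \<in> sa" for X' Y'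
    using that by (intro blinfun_eqI) (simp add: sa_iff adj_simps closed plus_blinfun.rep_eq
        uminus_blinfun.rep_eq scaleC_minus_left scaleC_minus_right)
  show ?thesis
    unfolding S(3) using S(1,2) by (simp add: adj complexify_cartesian sa_closed maps minus)
qed

lemma complexify_square:
  assumes sq: "\<And>X. X \<in> sa \<Longrightarrow> L (X o\<^sub>L X) = L X o\<^sub>L L X" and S: "S \<in> A"
  shows "complexify L (S o\<^sub>L S) = complexify L S o\<^sub>L complexify L S"
proof -
  obtain X Y where XY: "X \<in> sa" "Y \<in> sa" "S = X + scaleC_op \<i> Y" by (rule cartesian_decomposition[OF S])
  have square: "(X' + scaleC_op \<i> Y') o\<^sub>L (X' + scaleC_op \<i> Y') =
      ((X' o\<^sub>L X') - (Y' o\<^sub>L Y')) + scaleC_op \<i> ((X' o\<^sub>L Y') + (Y' o\<^sub>L X'))"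
    if "X' \<in> sa" "Y' \<in> sa" for X' Y'
    using that by (simp add: blinfun_compose_add scaleC_op_compose_left
        scaleC_op_compose_right[OF bounded[OF saD(1)]] scaleC_op_i_i scaleC_op_add)
  have anti_sa: "(X o\<^sub>L Y) + (Y o\<^sub>L X) \<in> sa"
    using XY by (simp add: sa_iff closed adj_simps add.commute)
  \<comment> \<open>Polarizing squares shows that \<open>L\<close> preserves \<open>X Y + Y X\<close>.\<close>
  have "L ((X + Y) o\<^sub>L (X + Y)) = (L X + L Y) o\<^sub>L (L X + L Y)"
    using XY by (simp add: sq sa_closed add)
  moreover have expand: "(X' + Y') o\<^sub>L (X' + Y') = ((X' o\<^sub>L X') + (Y' o\<^sub>L Y')) + ((X' o\<^sub>L Y') + (Y' o\<^sub>L X'))"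
    for X' Y' :: "'h \<Rightarrow>\<^sub>L 'h"
    by (simp add: blinfun_compose_add add_ac)
  moreover have "L (((X o\<^sub>L X) + (Y o\<^sub>L Y)) + ((X o\<^sub>L Y) + (Y o\<^sub>L X))) =
      ((L X o\<^sub>L L X) + (L Y o\<^sub>L L Y)) + L ((X o\<^sub>L Y) + (Y o\<^sub>L X))"
    using XY(1,2) anti_sa by (simp only: add sa_closed sa_square sq)
  ultimately have "L ((X o\<^sub>L Y) + (Y o\<^sub>L X)) = (L X o\<^sub>L L Y) + (L Y o\<^sub>L L X)"
    by (metis add_left_cancel)
  then show ?thesis
    unfolding XY(3) using XY(1,2) anti_sa
    by (simp add: square complexify_cartesian sa_closed sa_square maps diff sq)
qed

lemma complexify_inverse:
  assumes "sa_linear A M" "\<And>X. X \<in> sa \<Longrightarrow> M (L X) = X" "S \<in> A"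
  shows "complexify M (complexify L S) = S"
proof -
  interpret M: sa_linear A M by fact
  obtain X Y where XY: "X \<in> sa" "Y \<in> sa" "S = X + scaleC_op \<i> Y" by (rule cartesian_decomposition[OF assms(3)])
  then show ?thesis by (simp add: complexify_cartesian M.complexify_cartesian maps assms(2))
qed

end

context operator_algebra
begin

lemma nonneg_scaled_effect:
  assumes X: "X \<in> sa" "nonneg X"
  obtains r e where "0 < r" "e \<in> effects A" "X = r *\<^sub>R e"
proof -
  define r where "r = norm X + 1"
  have r: "r > 0" by (simp add: r_def add_nonneg_pos)
  define e where "e = (1 / r) *\<^sub>R X"
  have "nonneg ((1 / r) *\<^sub>R (r *\<^sub>R id_blinfun - X))"
    using r by (intro nonneg_scaleR nonneg_norm_bound) (simp_all add: r_def)
  then have "e \<in> effects A"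
    using X r by (simp add: effects_iff e_def sa_closed nonneg_scaleR scaleR_diff_right)
  then show thesis using that r by (simp add: e_def)
qed

text \<open>The extension is unital because \<open>I\<close> is the largest effect: if \<open>\<phi>(u) = I\<close> then
  \<open>L(I) \<ge> L(u) = I\<close>.\<close>

lemma effect_extension_unital_positive:
  assumes lin: "sa_linear A L" and L: "\<And>e. e \<in> effects A \<Longrightarrow> L e = \<phi> e"
    and surj: "\<phi> ` effects A = effects A"
  shows "unital_positive A L"
proof -
  interpret sa_linear A L by fact
  have in_E: "\<phi> e \<in> effects A" if "e \<in> effects A" for e using surj that by blast
  have pos: "nonneg (L X)" if X: "X \<in> sa" "nonneg X" for X
  proof -
    obtain r e where "0 < r" "e \<in> effects A" "X = r *\<^sub>R e" using nonneg_scaled_effect[OF X] .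
    then show ?thesis using in_E by (simp add: scale effectsD L nonneg_scaleR)
  qed
  obtain u where u: "u \<in> effects A" "\<phi> u = id_blinfun" using surj id_effect by (metis imageE)
  have "nonneg (L (id_blinfun - u))"
    using u effectsD[OF u(1)] by (intro pos) (simp_all add: sa_closed)
  then have "nonneg (L id_blinfun - id_blinfun)"
    using effectsD(1)[OF u(1)] L[OF u(1)] u(2) by (simp add: diff sa_closed)
  moreover have "nonneg (id_blinfun - L id_blinfun)"
    using effectsD(3)[OF in_E[OF id_effect]] L[OF id_effect] by simp
  ultimately have "L id_blinfun = id_blinfun"
    by (intro sa_order_antisym) (simp_all add: maps sa_closed)
  then show ?thesis by unfold_locales (use pos in blast)+
qed

text \<open>Kadison's inequality for the map and for its inverse gives equality on effects; squares
  of general self-adjoint elements follow by an affine substitution.\<close>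

lemma unital_order_isomorphism_square:
  assumes L: "unital_positive A L" and M: "unital_positive A M"
    and M_of_L: "\<And>X. X \<in> sa \<Longrightarrow> M (L X) = X" and L_of_M: "\<And>X. X \<in> sa \<Longrightarrow> L (M X) = X"
    and X: "X \<in> sa"
  shows "L (X o\<^sub>L X) = L X o\<^sub>L L X"
proof -
  interpret L: unital_positive A L by (rule L)
  interpret M: unital_positive A M by (rule M)
  have eff: "L a \<in> effects A" if a: "a \<in> effects A" for a
    unfolding effects_iff
    using L.maps L.positive[of a] L.positive[of "id_blinfun - a"] effectsD[OF a]
    by (simp add: L.diff L.unital sa_closed)
  have sq: "L (a o\<^sub>L a) = L a o\<^sub>L L a" if a: "a \<in> effects A" for a
  proof (rule sa_order_antisym)
    have as: "a \<in> sa" using effectsD[OF a] by blast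
    show s: "L (a o\<^sub>L a) \<in> sa" "L a o\<^sub>L L a \<in> sa" using as by (simp_all add: L.maps sa_square)
    show "nonneg (L (a o\<^sub>L a) - (L a o\<^sub>L L a))" by (rule L.Kadison_inequality[OF a])
    have "nonneg (M (L a o\<^sub>L L a) - (a o\<^sub>L a))"
      using M.Kadison_inequality[OF eff[OF a]] M_of_L[OF as] by simp
    then have "nonneg (L (M (L a o\<^sub>L L a) - (a o\<^sub>L a)))"
      by (intro L.positive) (simp_all add: sa_closed M.maps s sa_square as)
    then show "nonneg ((L a o\<^sub>L L a) - L (a o\<^sub>L a))"
      by (simp add: L.diff M.maps s sa_square as L_of_M)
  qed
  obtain r a where a: "a \<in> effects A" "X = r *\<^sub>R (2 *\<^sub>R a - id_blinfun)"
    using sa_affine_effect[OF X] by blast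
  have as: "a \<in> sa" using effectsD a by blast
  have expand: "(r *\<^sub>R (2 *\<^sub>R b - id_blinfun)) o\<^sub>L (r *\<^sub>R (2 *\<^sub>R b - id_blinfun)) =
      (r * r) *\<^sub>R (4 *\<^sub>R (b o\<^sub>L b) - 4 *\<^sub>R b + id_blinfun)" for b :: "'h \<Rightarrow>\<^sub>L 'h"
  proof -
    have "4 *\<^sub>R b = 2 *\<^sub>R b + 2 *\<^sub>R b" by (simp add: scaleR_add_left[symmetric])
    then have "(2 *\<^sub>R b - id_blinfun) o\<^sub>L (2 *\<^sub>R b - id_blinfun) = 4 *\<^sub>R (b o\<^sub>L b) - 4 *\<^sub>R b + id_blinfun"
      by (simp add: blinfun_compose_simps scaleR_diff_right)
    then show ?thesis by (simp add: blinfun_compose_scaleR)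
  qed
  have LX: "L X = r *\<^sub>R (2 *\<^sub>R L a - id_blinfun)"
    by (simp add: a(2) L.scale L.diff L.unital sa_closed as)
  have "L (X o\<^sub>L X) = (r * r) *\<^sub>R (4 *\<^sub>R L (a o\<^sub>L a) - 4 *\<^sub>R L a + id_blinfun)"
    unfolding a(2) expand by (simp add: L.scale L.diff L.add L.unital sa_closed as sa_square)
  then show ?thesis unfolding LX expand by (simp add: sq[OF a(1)])
qed

lemma factor_effect_automorphism_fixing_zero:
  assumes closedA: "closedin strong_operator_topology A"
    and center: "op_center A = range (\<lambda>c. scaleC_op c id_blinfun)"
    and bij: "bij_betw \<phi> (effects A) (effects A)" and aff: "affine_fun_on (effects A) \<phi>"
    and zero: "\<phi> 0 = 0"
  shows "\<exists>\<Phi>. (star_automorphism A \<Phi> \<or> star_antiautomorphism A \<Phi>) \<and>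
    \<Phi> id_blinfun = id_blinfun \<and> (\<forall>T\<in>effects A. \<phi> T = \<Phi> T)"
proof -
  define \<eta> where "\<eta> = inv_into (effects A) \<phi>"
  obtain L M where lin: "sa_linear A L" "sa_linear A M"
    and L: "\<And>a b. a \<in> effects A \<Longrightarrow> b \<in> effects A \<Longrightarrow> L (a - b) = \<phi> a - \<phi> b"
    and M: "\<And>a b. a \<in> effects A \<Longrightarrow> b \<in> effects A \<Longrightarrow> M (a - b) = \<eta> a - \<eta> b"
    and L_of_M: "\<And>X. X \<in> sa \<Longrightarrow> L (M X) = X" and M_of_L: "\<And>X. X \<in> sa \<Longrightarrow> M (L X) = X"
    using effect_bijection_extension[OF bij aff] unfolding \<eta>_def by metis
  interpret L: sa_linear A L by (rule lin)
  interpret M: sa_linear A M by (rule lin)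
  have \<eta>0: "\<eta> 0 = 0" unfolding \<eta>_def using zero bij zero_effect bij_betw_inv_into_left by metis
  have L_eff: "L e = \<phi> e" if "e \<in> effects A" for e using L[OF that zero_effect] zero by simp
  have M_eff: "M e = \<eta> e" if "e \<in> effects A" for e using M[OF that zero_effect] \<eta>0 by simp
  have UL: "unital_positive A L"
    by (rule effect_extension_unital_positive[OF lin(1) L_eff]) (use bij in \<open>auto simp: bij_betw_def\<close>)
  have UM: "unital_positive A M"
    by (rule effect_extension_unital_positive[OF lin(2) M_eff])
      (use bij_betw_inv_into[OF bij] in \<open>auto simp: bij_betw_def \<eta>_def\<close>)
  have sq: "L (X o\<^sub>L X) = L X o\<^sub>L L X" if "X \<in> sa" for X
    by (rule unital_order_isomorphism_square[OF UL UM M_of_L L_of_M that])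
  define \<Phi> where "\<Phi> = complexify L"
  have bij\<Phi>: "bij_betw \<Phi> A A"
    unfolding \<Phi>_def
    by (rule bij_betw_byWitness[where f' = "complexify M"])
      (use L.complexify_inverse[OF lin(2) M_of_L] M.complexify_inverse[OF lin(1) L_of_M]
        L.complexify_closed M.complexify_closed in auto)
  have star: "star_linear_bij A \<Phi>"
    unfolding star_linear_bij_def using bij\<Phi>
    by (simp add: \<Phi>_def L.complexify_add L.complexify_scaleC L.complexify_adj)
  have "(\<forall>a\<in>A. \<forall>b\<in>A. \<Phi> (a o\<^sub>L b) = \<Phi> a o\<^sub>L \<Phi> b) \<or> (\<forall>a\<in>A. \<forall>b\<in>A. \<Phi> (a o\<^sub>L b) = \<Phi> b o\<^sub>L \<Phi> a)"
  proof (rule Jordan_onto_prime)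
    show "\<Phi> ` A = A" using bij\<Phi> by (simp add: bij_betw_def)
    show "\<Phi> (a + b) = \<Phi> a + \<Phi> b" if "a \<in> A" "b \<in> A" for a b
      unfolding \<Phi>_def by (rule L.complexify_add[OF that])
    show "\<Phi> (a o\<^sub>L a) = \<Phi> a o\<^sub>L \<Phi> a" if "a \<in> A" for a
      unfolding \<Phi>_def by (rule L.complexify_square[OF sq that])
  qed (rule factor_prime[OF closedA center])
  then have "star_automorphism A \<Phi> \<or> star_antiautomorphism A \<Phi>"
    using star unfolding star_automorphism_def star_antiautomorphism_def by blast
  moreover have "\<Phi> T = L T" if "T \<in> effects A" for T
    unfolding \<Phi>_def using L.complexify_sa effectsD(1)[OF that] .
  moreover have "L id_blinfun = id_blinfun" using unital_positive.unital[OF UL] .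
  ultimately show ?thesis using L_eff id_effect by (metis (no_types, lifting))
qed

end

section \<open>Affine automorphisms of the effects of a factor\<close>

theorem theorem1:
  fixes \<A> :: "('h::chilbert_space \<Rightarrow>\<^sub>L 'h) set"
    and \<phi> :: "('h \<Rightarrow>\<^sub>L 'h) \<Rightarrow> ('h \<Rightarrow>\<^sub>L 'h)"
  assumes "factor \<A>"
    and "bij_betw \<phi> (effects \<A>) (effects \<A>)"
    and "affine_fun_on (effects \<A>) \<phi>"
  shows "\<exists>\<Phi>. (star_automorphism \<A> \<Phi> \<or> star_antiautomorphism \<A> \<Phi>) \<and>
    ((\<forall>T\<in>effects \<A>. \<phi> T = \<Phi> T) \<or>
     (\<forall>T\<in>effects \<A>. \<phi> T = \<Phi> (id_blinfun - T)))"
proof -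
  have vN: "von_neumann_algebra \<A>" and center: "op_center \<A> = range (\<lambda>c. scaleC_op c id_blinfun)"
    using assms(1) by (auto simp: factor_def)
  interpret operator_algebra \<A>
    by unfold_locales (use vN in \<open>auto simp: von_neumann_algebra_def\<close>)
  have closedA: "closedin strong_operator_topology \<A>"
    using vN by (simp add: von_neumann_algebra_def)
  show ?thesis
  proof (cases "\<phi> 0 = 0")
    case True
    then show ?thesis
      using factor_effect_automorphism_fixing_zero[OF closedA center assms(2,3)] by blast
  next
    case False
    then have \<phi>0: "\<phi> 0 = id_blinfun"
      using image_of_zero_trivial[OF center assms(2,3)] by blast
    \<comment> \<open>The complemented map \<open>I - \<phi>\<close> fixes zero, and \<open>I - \<Phi>(T) = \<Phi>(I - T)\<close> for unital
      additive \<open>\<Phi>\<close>.\<close>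
    define \<phi>' where "\<phi>' T = id_blinfun - \<phi> T" for T
    have "bij_betw (\<lambda>T. id_blinfun - T) (effects \<A>) (effects \<A>)"
      by (rule bij_betw_byWitness[where f' = "\<lambda>T. id_blinfun - T"]) (auto intro: effects_complement)
    then have bij: "bij_betw \<phi>' (effects \<A>) (effects \<A>)"
      using bij_betw_trans[OF assms(2)] by (simp add: \<phi>'_def[abs_def] comp_def)
    have aff: "affine_fun_on (effects \<A>) \<phi>'"
      using assms(3) by (simp add: affine_fun_on_def \<phi>'_def algebra_simps)
    have "\<phi>' 0 = 0" by (simp add: \<phi>'_def \<phi>0)
    then obtain \<Phi> where \<Phi>: "star_automorphism \<A> \<Phi> \<or> star_antiautomorphism \<A> \<Phi>"
      "\<Phi> id_blinfun = id_blinfun" "\<forall>T\<in>effects \<A>. \<phi>' T = \<Phi> T"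
      using factor_effect_automorphism_fixing_zero[OF closedA center bij aff] by blast
    have "star_linear_bij \<A> \<Phi>"
      using \<Phi>(1) by (auto simp: star_automorphism_def star_antiautomorphism_def)
    then have add: "\<Phi> (S + T) = \<Phi> S + \<Phi> T" if "S \<in> \<A>" "T \<in> \<A>" for S T
      using that by (simp add: star_linear_bij_def)
    have "\<phi> T = \<Phi> (id_blinfun - T)" if T: "T \<in> effects \<A>" for T
    proof -
      have "T \<in> \<A>" using effectsD(1)[OF T] saD by blast
      then have "\<Phi> (id_blinfun - T) + \<Phi> T = id_blinfun"
        using add[of "id_blinfun - T" T] \<Phi>(2) by (simp add: closed)
      moreover have "\<phi> T = id_blinfun - \<Phi> T" using \<Phi>(3) T unfolding \<phi>'_def by (simp add: algebra_simps)
      ultimately show ?thesis by (metis add_diff_cancel_right')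
    qed
    then show ?thesis using \<Phi>(1) by blast
  qed
qed

end
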